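(* There is no first-order sentence $\sigma$ in the language of groups such that for every finite group $G$ one has $G\models\sigma$ if and only if $G$ is perfect.
   Context: The first-order language of group theory has a binary operation for multiplication, a unary operation for inverse, and a constant for $1$; a sentence is a formula with no free variable. A group is perfect if it equals its derived subgroup. *)

theory Defs
  imports "HOL-Algebra.Algebra"
begin

section \<open>The first-order language of group theory\<close>

datatype gterm =
    Var nat
  | One
  | Mult gterm gterm
  | Inverse gterm

datatype gform =
    Eq gterm gterm
  | Neg gform
  | Conj gform gform
  | Disj gform gform
  | Impl gform gform
  | Forall nat gform
  | Exists nat gform

primrec vars_gterm :: "gterm \<Rightarrow> nat set" where
  "vars_gterm (Var n) = {n}"
| "vars_gterm One = {}"
| "vars_gterm (Mult s t) = vars_gterm s \<union> vars_gterm t"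
| "vars_gterm (Inverse t) = vars_gterm t"

primrec free_vars :: "gform \<Rightarrow> nat set" where
  "free_vars (Eq s t) = vars_gterm s \<union> vars_gterm t"
| "free_vars (Neg p) = free_vars p"
| "free_vars (Conj p q) = free_vars p \<union> free_vars q"
| "free_vars (Disj p q) = free_vars p \<union> free_vars q"
| "free_vars (Impl p q) = free_vars p \<union> free_vars q"
| "free_vars (Forall n p) = free_vars p - {n}"
| "free_vars (Exists n p) = free_vars p - {n}"

definition sentence :: "gform \<Rightarrow> bool" where
  "sentence p \<longleftrightarrow> free_vars p = {}"

primrec gterm_val :: "('a, 'b) monoid_scheme \<Rightarrow> (nat \<Rightarrow> 'a) \<Rightarrow> gterm \<Rightarrow> 'a" where
  "gterm_val G e (Var n) = e n"
| "gterm_val G e One = \<one>\<^bsub>G\<^esub>"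
| "gterm_val G e (Mult s t) = gterm_val G e s \<otimes>\<^bsub>G\<^esub> gterm_val G e t"
| "gterm_val G e (Inverse t) = inv\<^bsub>G\<^esub> (gterm_val G e t)"

primrec sat :: "('a, 'b) monoid_scheme \<Rightarrow> (nat \<Rightarrow> 'a) \<Rightarrow> gform \<Rightarrow> bool" where
  "sat G e (Eq s t) \<longleftrightarrow> gterm_val G e s = gterm_val G e t"
| "sat G e (Neg p) \<longleftrightarrow> \<not> sat G e p"
| "sat G e (Conj p q) \<longleftrightarrow> sat G e p \<and> sat G e q"
| "sat G e (Disj p q) \<longleftrightarrow> sat G e p \<or> sat G e q"
| "sat G e (Impl p q) \<longleftrightarrow> (sat G e p \<longrightarrow> sat G e q)"
| "sat G e (Forall n p) \<longleftrightarrow> (\<forall>x\<in>carrier G. sat G (e(n := x)) p)"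
| "sat G e (Exists n p) \<longleftrightarrow> (\<exists>x\<in>carrier G. sat G (e(n := x)) p)"

text \<open>Truth under all assignments into the carrier; for a sentence the assignment is immaterial.\<close>

definition models :: "('a, 'b) monoid_scheme \<Rightarrow> gform \<Rightarrow> bool" (infix "\<Turnstile>" 50) where
  "G \<Turnstile> p \<longleftrightarrow> (\<forall>e. range e \<subseteq> carrier G \<longrightarrow> sat G e p)"

definition perfect_group :: "('a, 'b) monoid_scheme \<Rightarrow> bool" where
  "perfect_group G \<longleftrightarrow> group G \<and> derived G (carrier G) = carrier G"

section \<open>Finite groups may be taken with carrier in the natural numbers\<close>

text \<open>
  HOL cannot quantify over all types inside a formula. Satisfaction and perfectness are
  invariant under isomorphism, and every finite group is isomorphic to one whose elements
  are natural numbers; so a sentence characterises perfectness among all finite groups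
  as soon as it does so among the finite groups of type \<^typ>\<open>nat monoid\<close>.
\<close>

lemma gterm_val_closed:
  assumes "group G" "range e \<subseteq> carrier G"
  shows "gterm_val G e t \<in> carrier G"
proof -
  interpret group G by fact
  show ?thesis using assms(2) by (induction t) auto
qed

lemma gterm_val_iso:
  assumes "group G" "group H" "h \<in> iso G H" "range e \<subseteq> carrier G"
  shows "gterm_val H (h \<circ> e) t = h (gterm_val G e t)"
proof -
  interpret group_hom G H h
    using assms by (simp add: group_hom_def group_hom_axioms_def iso_def)
  show ?thesis
    using gterm_val_closed[OF assms(1,4)] by (induction t) auto
qed

lemma sat_iso:
  assumes "group G" "group H" "h \<in> iso G H" "range e \<subseteq> carrier G"
  shows "sat H (h \<circ> e) p \<longleftrightarrow> sat G e p"
  using assms(4)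
proof (induction p arbitrary: e)
  case (Eq s t)
  have "inj_on h (carrier G)"
    using assms(3) by (auto simp: iso_def bij_betw_def)
  then show ?case
    using gterm_val_closed[OF assms(1) Eq]
    by (simp add: gterm_val_iso[OF assms(1-3) Eq] inj_on_eq_iff del: comp_apply)
next
  case (Forall n p)
  have "carrier H = h ` carrier G"
    using assms(3) by (auto simp: iso_def bij_betw_def)
  moreover have "sat H ((h \<circ> e)(n := h x)) p \<longleftrightarrow> sat G (e(n := x)) p" if "x \<in> carrier G" for x
  proof -
    have "range (e(n := x)) \<subseteq> carrier G"
      using Forall.prems that by auto
    moreover have "h \<circ> e(n := x) = (h \<circ> e)(n := h x)"
      by auto
    ultimately show ?thesis
      using Forall.IH[of "e(n := x)"] by metis
  qed
  ultimately show ?case by (simp del: comp_apply)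
next
  case (Exists n p)
  have "carrier H = h ` carrier G"
    using assms(3) by (auto simp: iso_def bij_betw_def)
  moreover have "sat H ((h \<circ> e)(n := h x)) p \<longleftrightarrow> sat G (e(n := x)) p" if "x \<in> carrier G" for x
  proof -
    have "range (e(n := x)) \<subseteq> carrier G"
      using Exists.prems that by auto
    moreover have "h \<circ> e(n := x) = (h \<circ> e)(n := h x)"
      by auto
    ultimately show ?thesis
      using Exists.IH[of "e(n := x)"] by metis
  qed
  ultimately show ?case by (simp del: comp_apply)
qed auto

lemma models_iso_imp:
  assumes "group G" "group H" "h \<in> iso G H" "H \<Turnstile> p"
  shows "G \<Turnstile> p"
  unfolding models_def
proof (intro allI impI)
  fix e :: "nat \<Rightarrow> 'a" assume e: "range e \<subseteq> carrier G"
  have "range (h \<circ> e) \<subseteq> carrier H"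
    using e assms(3) by (auto simp: iso_def bij_betw_def)
  then have "sat H (h \<circ> e) p"
    using assms(4) unfolding models_def by blast
  then show "sat G e p"
    using sat_iso[OF assms(1-3) e] by blast
qed

lemma models_iso:
  assumes "group G" "group H" "h \<in> iso G H"
  shows "G \<Turnstile> p \<longleftrightarrow> H \<Turnstile> p"
  using models_iso_imp[OF assms] models_iso_imp[OF assms(2,1) group.iso_set_sym[OF assms(1,3)]]
  by blast

lemma perfect_group_iso:
  assumes "group G" "group H" "h \<in> iso G H"
  shows "perfect_group G \<longleftrightarrow> perfect_group H"
proof -
  interpret group_hom G H h
    using assms by (simp add: group_hom_def group_hom_axioms_def iso_def)
  have h: "inj_on h (carrier G)" "h ` carrier G = carrier H"
    using assms(3) by (auto simp: iso_def bij_betw_def)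
  have "derived H (carrier H) = h ` derived G (carrier G)"
    using derived_img[of "carrier G"] h(2) by simp
  moreover have "derived G (carrier G) \<subseteq> carrier G"
    using group.derived_in_carrier[OF assms(1)] by simp
  ultimately show ?thesis
    using h assms(1,2) inj_on_image_eq_iff[OF h(1), of "derived G (carrier G)" "carrier G"]
    by (simp add: perfect_group_def)
qed

lemma characterises_perfect_if_nat:
  fixes G :: "('a, 'b) monoid_scheme"
  assumes nat: "\<And>H :: nat monoid. group H \<Longrightarrow> finite (carrier H) \<Longrightarrow> H \<Turnstile> p \<longleftrightarrow> perfect_group H"
    and G: "group G" "finite (carrier G)"
  shows "G \<Turnstile> p \<longleftrightarrow> perfect_group G"
proof -
  obtain f :: "'a \<Rightarrow> nat" where f: "inj_on f (carrier G)"
    using finite_imp_inj_to_nat_seg[OF G(2)] by blast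
  have H: "group (image_group f G)"
    using group.inj_imp_image_group_is_group[OF G(1) f] .
  have iso: "f \<in> iso G (image_group f G)"
    using inj_imp_image_group_iso[OF f] .
  have "finite (carrier (image_group f G))"
    using G(2) by (simp add: image_group_def)
  then show ?thesis
    using nat[OF H] models_iso[OF G(1) H iso] perfect_group_iso[OF G(1) H iso] by simp
qed

end

theory Submission
  imports Defs "HOL-Library.Function_Algebras" "HOL-Library.Z2"
begin

text \<open>
  No sentence can say that a group is perfect, because it cannot see whether an element that is not
  a short product of commutators is a long one. The proof exhibits, for every sentence \<open>\<sigma>\<close>, a perfect
  and an imperfect finite group on which \<open>\<sigma>\<close> has the same truth value.

  Let \<open>F\<close> be the field with two elements and let the alternating group \<open>A\<close> on five letters permute the
  entries of the tuples in \<open>F\<^sup>n\<close> of length five with sum zero. Let \<open>P\<close> be the set of all \<open>(s, u, w, z)\<close>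
  with \<open>s\<close> in \<open>A\<close>, two such tuples \<open>u\<close> and \<open>w\<close>, and an \<open>n \<times> n\<close> matrix \<open>z\<close>, where \<open>A\<close> acts on the
  tuples and the commutator of \<open>u\<close> and \<open>w\<close> is the matrix \<open>\<Sum>j. u j \<otimes> w j\<close>. It is perfect, as matrices are
  sums of matrices of rank one (\<open>heis_perfect\<close>), but a matrix of large rank is not a product of few
  commutators. Allowing one further matrix entry, at \<open>(n, n)\<close>, gives the direct product of \<open>P\<close> with a
  group of order two, which is not perfect (\<open>heis_not_perfect\<close>).

  The two groups are compared in an Ehrenfeucht--Fraisse game. A position is a partial isomorphism that
  matches few vectors and few matrices and respects outer products, such that matched matrices of small
  rank involve matched vectors only. A new vector is answered by any new vector
  (\<open>position_add_vector\<close>). A new matrix that differs by a matrix of small rank from a matched one is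
  answered by answering the vectors in the difference (\<open>position_add_near_matrix\<close>). Every other matrix
  is answered by a matrix that is far from all matched ones; such a matrix exists by counting if \<open>n\<close> is
  large (\<open>position_add_far_matrix\<close>). In this last case it makes no difference whether the matrix lies
  in the span of the outer products, and this is where perfectness escapes. Induction on formulas turns
  these replies into \<open>sentence_agreement\<close>: for large \<open>n\<close> the two groups satisfy the same one of \<open>\<sigma>\<close> and
  its negation.
\<close>

section \<open>Vectors and matrices over the field of two elements\<close>

type_synonym vec = "nat \<Rightarrow> bit"
type_synonym mat = "nat \<Rightarrow> nat \<Rightarrow> bit"

(* By default, sums and products of bits are rewritten to bitwise operations. *)
declare add_bit_eq_xor [simp del] mult_bit_eq_and [simp del]

definition vecs :: "nat \<Rightarrow> vec set" where
  "vecs n = {a. \<forall>i\<ge>n. a i = 0}"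

definition mats :: "(nat \<times> nat) set \<Rightarrow> mat set" where
  "mats E = {z. \<forall>i j. (i, j) \<notin> E \<longrightarrow> z i j = 0}"

definition outer :: "vec \<Rightarrow> vec \<Rightarrow> mat" where
  "outer a b = (\<lambda>i j. a i * b j)"

lemma bit_add_self: "(x :: bit) + x = 0"
  by (cases x) auto

lemma vec_add_self: "(a :: vec) + a = 0"
  by (simp add: fun_eq_iff bit_add_self)

lemma mat_add_self: "(z :: mat) + z = 0"
  by (simp add: fun_eq_iff bit_add_self)

lemma mat_add_cancel: "(z :: mat) + (z + w) = w"
  by (simp add: mat_add_self flip: add.assoc)

lemma vec_add_cancel: "(a :: vec) + (a + b) = b"
  by (simp add: vec_add_self flip: add.assoc)

lemma mat_add_eq_0_iff: "(z :: mat) + w = 0 \<longleftrightarrow> z = w"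
  by (metis mat_add_cancel add.right_neutral mat_add_self)

lemma vec_add_eq_0_iff: "(a :: vec) + b = 0 \<longleftrightarrow> a = b"
  by (metis vec_add_cancel add.right_neutral vec_add_self)

lemma vecs_0: "0 \<in> vecs n" by (simp add: vecs_def)
lemma vecs_add: "a \<in> vecs n \<Longrightarrow> b \<in> vecs n \<Longrightarrow> a + b \<in> vecs n"
  by (simp add: vecs_def)
lemma mats_0: "0 \<in> mats E" by (simp add: mats_def)
lemma mats_add: "a \<in> mats E \<Longrightarrow> b \<in> mats E \<Longrightarrow> a + b \<in> mats E"
  by (simp add: mats_def)
lemma outer_in_mats:
  "{..<n} \<times> {..<n} \<subseteq> E \<Longrightarrow> a \<in> vecs n \<Longrightarrow> b \<in> vecs n \<Longrightarrow> outer a b \<in> mats E"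
  unfolding mats_def vecs_def outer_def
  by (simp add: subset_iff) (metis mult_zero_left mult_zero_right not_less)

lemma outer_add_left: "outer (a + b) c = outer a c + outer b c"
  and outer_add_right: "outer a (b + c) = outer a b + outer a c"
  by (auto simp: outer_def fun_eq_iff algebra_simps)
lemma outer_0_left [simp]: "outer 0 c = 0" and outer_0_right [simp]: "outer c 0 = 0"
  by (auto simp: outer_def fun_eq_iff)

lemma bij_betw_vecs: "bij_betw (\<lambda>S i. of_bool (i \<in> S)) (Pow {..<n}) (vecs n)"
  by (rule bij_betw_byWitness[where f' = "\<lambda>a. {i. a i \<noteq> 0}"])
    (auto simp: vecs_def fun_eq_iff not_less[symmetric])

lemma bij_betw_mats: "bij_betw (\<lambda>S i j. of_bool ((i, j) \<in> S)) (Pow E) (mats E)"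
  by (rule bij_betw_byWitness[where f' = "\<lambda>a. {(i, j). a i j \<noteq> 0}"])
    (force simp: mats_def fun_eq_iff)+

lemma card_vecs: "card (vecs n) = 2 ^ n"
  using bij_betw_same_card[OF bij_betw_vecs, of n] by (simp add: card_Pow)

lemma card_mats: "finite E \<Longrightarrow> card (mats E) = 2 ^ card E"
  using bij_betw_same_card[OF bij_betw_mats, of E] by (simp add: card_Pow)

lemma finite_vecs: "finite (vecs n)"
  using bij_betw_finite[OF bij_betw_vecs, of n] by simp

lemma finite_mats: "finite E \<Longrightarrow> finite (mats E)"
  using bij_betw_finite[OF bij_betw_mats, of E] by simp

text \<open>
  Membership in \<open>low_rank n k\<close> is having rank at most \<open>k\<close>. The inductive form gives at once the two facts
  that are used: there are few such matrices, and \<open>2 * k\<close> vectors suffice to account for one of them.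
\<close>

primrec low_rank :: "nat \<Rightarrow> nat \<Rightarrow> mat set" where
  "low_rank n 0 = {0}"
| "low_rank n (Suc k) = (\<lambda>(z, a, b). z + outer a b) ` (low_rank n k \<times> vecs n \<times> vecs n)"

lemma low_rank_add_outer:
  "z \<in> low_rank n k \<Longrightarrow> a \<in> vecs n \<Longrightarrow> b \<in> vecs n \<Longrightarrow> z + outer a b \<in> low_rank n (Suc k)"
  by force

lemma low_rank_mono:
  assumes "k \<le> l" shows "low_rank n k \<subseteq> low_rank n l"
  using assms
proof (rule lift_Suc_mono_le[rotated])
  fix k show "low_rank n k \<subseteq> low_rank n (Suc k)"
    using low_rank_add_outer[OF _ vecs_0 vecs_0] by fastforce
qed

lemma zero_low_rank: "0 \<in> low_rank n k"
  using low_rank_mono[of 0 k n] by auto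

lemma finite_low_rank: "finite (low_rank n k)"
  by (induction k) (auto simp: finite_vecs)

lemma card_low_rank: "card (low_rank n k) \<le> 2 ^ (2 * n * k)"
proof (induction k)
  case (Suc k)
  have "card (low_rank n (Suc k)) \<le> card (low_rank n k \<times> vecs n \<times> vecs n)"
    unfolding low_rank.simps by (rule card_image_le) (simp add: finite_low_rank finite_vecs)
  also have "\<dots> \<le> 2 ^ (2 * n * k) * (2 ^ n * 2 ^ n)"
    using Suc by (simp add: card_cartesian_product card_vecs)
  also have "\<dots> = 2 ^ (2 * n * Suc k)"
    by (simp add: algebra_simps flip: power_add)
  finally show ?case .
qed simp

definition lines_in :: "mat \<Rightarrow> vec set \<Rightarrow> bool" where
  "lines_in z A \<longleftrightarrow> (\<forall>i. z i \<in> A) \<and> (\<forall>j. (\<lambda>i. z i j) \<in> A)"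

text \<open>
  The independence of tensor products, in the one case that is used: a matrix with all lines in a
  subgroup \<open>A\<close> cannot be cancelled by products with a vector \<open>x\<close> outside \<open>A\<close>. If \<open>b j = 1\<close>, column \<open>j\<close> of
  the equation writes \<open>x\<close> as an element of \<open>A\<close>; so \<open>b = 0\<close>, and then the rows do the same for \<open>c\<close>.
\<close>

lemma tensor_independent:
  assumes A: "0 \<in> A" "\<And>a b. a \<in> A \<Longrightarrow> b \<in> A \<Longrightarrow> a + b \<in> A"
    and z: "lines_in z A" and x: "x \<notin> A" and c: "c \<in> A"
    and eq: "z + outer x b + outer c x = 0"
  shows "z = 0" "b = 0" "c = 0"
proof -
  have eq': "z i j + x i * b j + c i * x j = 0" for i j
    using fun_cong[OF fun_cong[OF eq], of i j] by (simp add: outer_def)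
  have "b j = 0" for j
  proof (rule ccontr)
    assume "b j \<noteq> 0"
    then have bj: "b j = 1" by simp
    have cx: "(\<lambda>i. c i * x j) \<in> A"
      using A(1) c by (cases "x j") (simp_all add: zero_fun_def)
    have "x i = z i j + c i * x j" for i
      using eq'[of i j] bj by (cases "x i"; cases "z i j"; cases "c i * x j") auto
    then have "x = (\<lambda>i. z i j) + (\<lambda>i. c i * x j)"
      unfolding fun_eq_iff plus_fun_apply by blast
    moreover have "(\<lambda>i. z i j) + (\<lambda>i. c i * x j) \<in> A"
      using A(2)[OF _ cx] z by (simp add: lines_in_def)
    ultimately show False using x by simp
  qed
  then show b: "b = 0" by (simp add: fun_eq_iff)
  have "c i = 0" for i
  proof (rule ccontr)
    assume "c i \<noteq> 0"
    then have "x j = z i j" for j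
      using eq'[of i j] b by (cases "x j"; cases "z i j") auto
    then have "x = z i" by (simp add: fun_eq_iff)
    then show False using z x by (auto simp: lines_in_def)
  qed
  then show c: "c = 0" by (simp add: fun_eq_iff)
  show "z = 0" using eq b c by simp
qed

section \<open>Positions of the game\<close>

text \<open>
  For groups of exponent two, a matching is the graph of an isomorphism between subgroups. Relations
  are more convenient than maps here, because the converse exchanges the two sides of the game.
\<close>

definition matching :: "('a :: comm_monoid_add \<times> 'b :: comm_monoid_add) set \<Rightarrow> bool" where
  "matching R \<longleftrightarrow> (0, 0) \<in> R
    \<and> (\<forall>a a' b b'. (a, a') \<in> R \<longrightarrow> (b, b') \<in> R \<longrightarrow> (a + b, a' + b') \<in> R)
    \<and> (\<forall>a a'. (a, a') \<in> R \<longrightarrow> (a = 0 \<longleftrightarrow> a' = 0))"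

lemma matching_0: "matching R \<Longrightarrow> (0, 0) \<in> R"
  and matching_add: "matching R \<Longrightarrow> (a, a') \<in> R \<Longrightarrow> (b, b') \<in> R \<Longrightarrow> (a + b, a' + b') \<in> R"
  and matching_eq_0: "matching R \<Longrightarrow> (a, a') \<in> R \<Longrightarrow> a = 0 \<longleftrightarrow> a' = 0"
  unfolding matching_def by blast+

lemma matching_converse: "matching R \<Longrightarrow> matching (R\<inverse>)"
  unfolding matching_def by auto

lemma matching_sum:
  assumes "matching R" "\<And>i. i \<in> I \<Longrightarrow> (f i, g i) \<in> R"
  shows "(sum f I, sum g I) \<in> R"
  using assms(2)
  by (induction I rule: infinite_finite_induct)
    (simp_all add: matching_0[OF assms(1)] matching_add[OF assms(1)])

lemma matching_eq_iff:
  fixes R :: "('a :: comm_monoid_add \<times> 'a) set"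
  assumes "matching R" "\<And>a b :: 'a. a + b = 0 \<longleftrightarrow> a = b" "(a, a') \<in> R" "(b, b') \<in> R"
  shows "a = b \<longleftrightarrow> a' = b'"
  using matching_eq_0[OF assms(1) matching_add[OF assms(1,3,4)]] assms(2) by simp

text \<open>
  The condition that makes a partial isomorphism extendable: the matrices of rank at most \<open>K\<close> that are
  matched involve only vectors that are matched. So the rank of a matched matrix, when it is small,
  never depends on vectors that have not been considered. \<open>K\<close> measures how much of the game can still
  be played.
\<close>

definition low_rank_controlled :: "nat \<Rightarrow> nat \<Rightarrow> (vec \<times> vec) set \<Rightarrow> (mat \<times> mat) set \<Rightarrow> bool" where
  "low_rank_controlled n K R Z \<longleftrightarrow> (\<forall>z z'. (z, z') \<in> Z \<longrightarrow> z \<in> low_rank n K \<longrightarrow> lines_in z (Domain R))"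

text \<open>
  A position of the Ehrenfeucht--Fraisse game between \<open>(F\<^sup>n, mats E)\<close> and \<open>(F\<^sup>n, mats E')\<close>, two-sorted
  structures of vectors and matrices with the outer product. The bound \<open>M\<close> on the sizes ensures that
  there is still room for a reply if \<open>n\<close> is large. A single relation \<open>R\<close> serves the left and the right
  factors of outer products.
\<close>

definition position ::
  "nat \<Rightarrow> (nat \<times> nat) set \<Rightarrow> (nat \<times> nat) set \<Rightarrow> nat \<Rightarrow> nat
    \<Rightarrow> (vec \<times> vec) set \<Rightarrow> (mat \<times> mat) set \<Rightarrow> bool" where
  "position n E E' K M R Z \<longleftrightarrow>
     R \<subseteq> vecs n \<times> vecs n \<and> Z \<subseteq> mats E \<times> mats E' \<and> matching R \<and> matching Z
     \<and> (\<forall>a a' b b'. (a, a') \<in> R \<longrightarrow> (b, b') \<in> R \<longrightarrow> (outer a b, outer a' b') \<in> Z)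
     \<and> low_rank_controlled n K R Z \<and> low_rank_controlled n K (R\<inverse>) (Z\<inverse>)
     \<and> card R \<le> M \<and> card Z \<le> M"

lemma position_converse:
  assumes "position n E E' K M R Z"
  shows "position n E' E K M (R\<inverse>) (Z\<inverse>)"
  using assms unfolding position_def
  by (auto simp: matching_converse)

lemma low_rank_controlled_mono: "low_rank_controlled n K R Z \<Longrightarrow> K' \<le> K \<Longrightarrow> low_rank_controlled n K' R Z"
  using low_rank_mono[of K' K n] unfolding low_rank_controlled_def by blast

lemma position_mono:
  assumes "position n E E' K M R Z" "K' \<le> K" "M \<le> M'"
  shows "position n E E' K' M' R Z"
  using assms low_rank_controlled_mono unfolding position_def by (meson order_trans)

section \<open>Replies to a vector and to a matrix\<close>

text \<open>
  In characteristic two this is the relation generated by \<open>R\<close> and the pair \<open>(x, x')\<close>.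
\<close>

definition adjoin :: "('a :: plus \<times> 'b :: plus) set \<Rightarrow> 'a \<Rightarrow> 'b \<Rightarrow> ('a \<times> 'b) set" where
  "adjoin R x x' = R \<union> {(a + x, a' + x') |a a'. (a, a') \<in> R}"

text \<open>
  Matching \<open>x\<close> with \<open>x'\<close> forces all products of \<open>x\<close> with matched vectors to be matched as well, including
  the square \<open>outer x x\<close>. That one is covered by letting \<open>b\<close>, but not \<open>c\<close>, range over the larger
  relation.
\<close>

definition adjoin_products ::
  "(vec \<times> vec) set \<Rightarrow> (mat \<times> mat) set \<Rightarrow> vec \<Rightarrow> vec \<Rightarrow> (mat \<times> mat) set" where
  "adjoin_products R Z x x' =
     {(z + outer x b + outer c x, z' + outer x' b' + outer c' x') |z z' b b' c c'.
        (z, z') \<in> Z \<and> (b, b') \<in> adjoin R x x' \<and> (c, c') \<in> R}"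

lemma adjoin_converse: "(adjoin R x x')\<inverse> = adjoin (R\<inverse>) x' x"
  unfolding adjoin_def by auto

lemma adjoin_products_converse:
  "(adjoin_products R Z x x')\<inverse> = adjoin_products (R\<inverse>) (Z\<inverse>) x' x"
  unfolding adjoin_products_def adjoin_converse[symmetric] by blast

lemma card_adjoin:
  assumes "finite R" shows "finite (adjoin R x x')" "card (adjoin R x x') \<le> 2 * card R"
proof -
  have eq: "adjoin R x x' = R \<union> (\<lambda>(a, a'). (a + x, a' + x')) ` R"
    unfolding adjoin_def by auto
  show "finite (adjoin R x x')" unfolding eq using assms by simp
  have "card (adjoin R x x') \<le> card R + card ((\<lambda>(a, a'). (a + x, a' + x')) ` R)"
    unfolding eq by (rule card_Un_le)
  then show "card (adjoin R x x') \<le> 2 * card R"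
    using card_image_le[OF assms, of "\<lambda>(a, a'). (a + x, a' + x')"] by simp
qed

lemma card_adjoin_products:
  assumes "finite R" "finite Z"
  shows "card (adjoin_products R Z x x') \<le> card Z * (2 * card R * card R)"
proof -
  have "adjoin_products R Z x x'
      \<subseteq> (\<lambda>((z, z'), (b, b'), (c, c')). (z + outer x b + outer c x, z' + outer x' b' + outer c' x'))
          ` (Z \<times> adjoin R x x' \<times> R)" (is "_ \<subseteq> ?f ` ?S")
  proof
    fix p assume "p \<in> adjoin_products R Z x x'"
    then obtain z z' b b' c c' where q: "(z, z') \<in> Z" "(b, b') \<in> adjoin R x x'" "(c, c') \<in> R"
      and p: "p = (z + outer x b + outer c x, z' + outer x' b' + outer c' x')"
      unfolding adjoin_products_def by blast
    show "p \<in> ?f ` ?S"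
      by (rule image_eqI[where x = "((z, z'), (b, b'), (c, c'))"]) (simp_all add: p q)
  qed
  then have "card (adjoin_products R Z x x') \<le> card (Z \<times> adjoin R x x' \<times> R)"
    by (intro surj_card_le) (simp_all add: assms card_adjoin(1))
  also have "\<dots> \<le> card Z * (2 * card R * card R)"
    using card_adjoin(2)[OF assms(1), of x x'] by (simp add: card_cartesian_product)
  finally show ?thesis .
qed

lemma adjoin_closed:
  fixes R :: "('a :: comm_monoid_add \<times> 'b :: comm_monoid_add) set"
  assumes R: "matching R" and self: "x + x = 0" "x' + x' = 0"
    and a: "(a, a') \<in> adjoin R x x'" and b: "(b, b') \<in> adjoin R x x'"
  shows "(a + b, a' + b') \<in> adjoin R x x'"
proof -
  have old: "(c, c') \<in> adjoin R x x'" "(c + x, c' + x') \<in> adjoin R x x'"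
    if "(c, c') \<in> R" for c c'
    using that by (auto simp: adjoin_def)
  have split: "\<exists>c c'. (c, c') \<in> R \<and> ((d, d') = (c, c') \<or> (d, d') = (c + x, c' + x'))"
    if "(d, d') \<in> adjoin R x x'" for d d'
    using that by (auto simp: adjoin_def)
  have double: "c + y + (d + y) = c + d" if "y + y = 0" for c d y :: "'c :: comm_monoid_add"
  proof -
    have "c + y + (d + y) = c + d + (y + y)" by (simp only: ac_simps)
    then show ?thesis using that by simp
  qed
  obtain c c' where c: "(c, c') \<in> R" "(a, a') = (c, c') \<or> (a, a') = (c + x, c' + x')"
    using split[OF a] by blast
  obtain d d' where d: "(d, d') \<in> R" "(b, b') = (d, d') \<or> (b, b') = (d + x, d' + x')"
    using split[OF b] by blast
  note sum = old[OF matching_add[OF R c(1) d(1)]]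
  have shift: "c + x + d = c + d + x" "c' + x' + d' = c' + d' + x'"
    "c + (d + x) = c + d + x" "c' + (d' + x') = c' + d' + x'"
    by (simp_all only: ac_simps)
  show ?thesis
    using c(2) d(2) sum
    by (elim disjE) (simp_all add: double[OF self(1)] double[OF self(2)] shift)
qed

lemma Domain_closed:
  assumes "matching R"
  shows "0 \<in> Domain R" "a \<in> Domain R \<Longrightarrow> b \<in> Domain R \<Longrightarrow> a + b \<in> Domain R"
  using matching_0[OF assms] matching_add[OF assms] by blast+

text \<open>
  One half of the invariants for the enlarged position; the other half is the same lemma for the
  converse relations. A new matrix \<open>y + outer x b + outer c x\<close> of rank at most \<open>K\<close> comes from a matched
  \<open>y\<close> of rank at most \<open>K + 2\<close>, whose lines are therefore matched. Hence the lines of the new matrix are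
  matched once \<open>x\<close> is, and \<open>tensor_independent\<close> excludes new coincidences.
\<close>

lemma adjoin_products_half:
  assumes R: "R \<subseteq> vecs n \<times> vecs n" "matching R" and Z: "matching Z"
    and refl: "low_rank_controlled n (K + 2) R Z" and x: "x \<in> vecs n" "x \<notin> Domain R"
  shows "\<And>z z'. (z, z') \<in> adjoin_products R Z x x' \<Longrightarrow> z = 0 \<Longrightarrow> z' = 0"
    and "low_rank_controlled n K (adjoin R x x') (adjoin_products R Z x x')"
    and "\<And>a a'. (a, a') \<in> adjoin R x x' \<Longrightarrow> a = 0 \<Longrightarrow> a' = 0"
proof -
  have x_adjoin: "(x, x') \<in> adjoin R x x'"
    using matching_0[OF R(2)] by (force simp: adjoin_def)
  have inj: "b' = 0" if "(b, b') \<in> adjoin R x x'" "b = 0" for b b'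
    using that matching_eq_0[OF R(2)] x(2) unfolding adjoin_def
    by (auto simp: vec_add_eq_0_iff)
  then show "\<And>a a'. (a, a') \<in> adjoin R x x' \<Longrightarrow> a = 0 \<Longrightarrow> a' = 0" .
  have adj_vecs: "b \<in> vecs n" if "(b, b') \<in> adjoin R x x'" for b b'
    using that R(1) x(1) by (auto simp: adjoin_def intro!: vecs_add)
  have low: "lines_in z (Domain R)"
    if "(z, z') \<in> Z" "(b, b') \<in> adjoin R x x'" "(c, c') \<in> R"
       "z + outer x b + outer c x \<in> low_rank n K" for z z' b b' c c'
  proof -
    have c: "c \<in> vecs n" using that(3) R(1) by auto
    have "z + outer x b + outer c x + outer x b + outer c x \<in> low_rank n (Suc (Suc K))"
      by (intro low_rank_add_outer that x(1) c adj_vecs[OF that(2)])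
    also have "z + outer x b + outer c x + outer x b + outer c x
        = z + (outer x b + outer x b) + (outer c x + outer c x)"
      by (simp only: ac_simps)
    finally have "z \<in> low_rank n (K + 2)"
      by (simp add: mat_add_self)
    then show ?thesis using refl that(1) unfolding low_rank_controlled_def by blast
  qed
  show "z' = 0" if zz: "(z, z') \<in> adjoin_products R Z x x'" and z: "z = 0" for z z'
  proof -
    obtain y y' b b' c c' where y: "(y, y') \<in> Z" "(b, b') \<in> adjoin R x x'" "(c, c') \<in> R"
      and eq: "z = y + outer x b + outer c x" "z' = y' + outer x' b' + outer c' x'"
      using zz unfolding adjoin_products_def by blast
    have 0: "y + outer x b + outer c x = 0" using eq z by simp
    have lin: "lines_in y (Domain R)"
      using low[OF y] 0 zero_low_rank by simp
    note ind = tensor_independent[OF Domain_closed[OF R(2)] lin x(2) _ 0]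
    have "y = 0" "b = 0" "c = 0" using ind y(3) by blast+
    then have "y' = 0" "b' = 0" "c' = 0"
      using matching_eq_0[OF Z y(1)] inj[OF y(2)] matching_eq_0[OF R(2) y(3)] by simp_all
    then show ?thesis using eq by simp
  qed
  show "low_rank_controlled n K (adjoin R x x') (adjoin_products R Z x x')"
    unfolding low_rank_controlled_def
  proof (intro allI impI)
    fix z z' assume zz: "(z, z') \<in> adjoin_products R Z x x'" and z: "z \<in> low_rank n K"
    obtain y y' b b' c c' where y: "(y, y') \<in> Z" "(b, b') \<in> adjoin R x x'" "(c, c') \<in> R"
      and eq: "z = y + outer x b + outer c x"
      using zz unfolding adjoin_products_def by blast
    let ?D = "Domain (adjoin R x x')"
    have lin: "lines_in y (Domain R)" using low[OF y] eq z by simp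
    have D: "0 \<in> ?D" "\<And>a b. a \<in> ?D \<Longrightarrow> b \<in> ?D \<Longrightarrow> a + b \<in> ?D"
      using matching_0[OF R(2)]
        adjoin_closed[OF R(2) vec_add_self[of x] vec_add_self[of x']]
      by (force simp: adjoin_def, blast)
    have scale: "(\<lambda>i. t * a i) \<in> ?D" "(\<lambda>i. a i * t) \<in> ?D" if "a \<in> ?D" for t a
      using that D(1) by (cases t; simp add: zero_fun_def)+
    have bxc: "b \<in> ?D" "x \<in> ?D" "c \<in> ?D"
      using y(2) x_adjoin y(3) by (blast, blast, auto simp: adjoin_def)
    have lin': "y i \<in> ?D" "(\<lambda>i. y i j) \<in> ?D" for i j
      using lin by (auto simp: lines_in_def adjoin_def)
    have "z i = y i + (\<lambda>j. x i * b j) + (\<lambda>j. c i * x j)" for i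
      by (simp add: eq outer_def fun_eq_iff)
    moreover have "(\<lambda>i. z i j) = (\<lambda>i. y i j) + (\<lambda>i. x i * b j) + (\<lambda>i. c i * x j)" for j
      by (simp add: eq outer_def fun_eq_iff)
    ultimately show "lines_in z ?D"
      unfolding lines_in_def using D(2) scale bxc lin' by simp
  qed
qed

text \<open>
  \<open>E\<close> is the set of indices at which matrices may have nonzero entries. The square is needed for the
  outer products; entries outside it cannot be reached by sums of outer products, and this is what
  will separate the perfect from the imperfect groups.
\<close>

definition contains_square :: "nat \<Rightarrow> (nat \<times> nat) set \<Rightarrow> bool" where
  "contains_square n E \<longleftrightarrow> {..<n} \<times> {..<n} \<subseteq> E \<and> finite E"

text \<open>
  A bound for the sizes after a vector has been adjoined: \<open>adjoin_products\<close> is parametrised by a matched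
  matrix, an element of the doubled vector relation and an element of the old one.
\<close>

definition grow :: "nat \<Rightarrow> nat" where
  "grow M = 2 * M ^ 3"

lemma le_grow: "2 * M \<le> grow M"
  by (cases "M = 0") (simp_all add: grow_def self_le_power)

lemma le_grow_pow: "M \<le> (grow ^^ k) M"
proof (induction k)
  case (Suc k)
  then show ?case using le_grow[of "(grow ^^ k) M"] by simp
qed simp

lemma position_finite:
  assumes "position n E E' K M R Z" "finite E" "finite E'"
  shows "finite R" "finite Z"
  using assms unfolding position_def
  by (meson finite_SigmaI finite_subset finite_vecs finite_mats)+

lemma exists_vec_outside:
  assumes "finite R" "card R < 2 ^ n"
  shows "\<exists>x'\<in>vecs n. x' \<notin> Range R"
proof (rule ccontr)
  assume "\<not> ?thesis"
  then have "vecs n \<subseteq> snd ` R" by (force simp: Range_snd)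
  then have "2 ^ n \<le> card R"
    using surj_card_le[OF assms(1)] by (metis card_vecs)
  then show False using assms(2) by simp
qed

lemma subset_adjoin: "R \<subseteq> adjoin R x x'"
  by (auto simp: adjoin_def)

lemma subset_adjoin_products:
  assumes "matching R" shows "Z \<subseteq> adjoin_products R Z x x'"
proof
  fix p assume "p \<in> Z"
  then show "p \<in> adjoin_products R Z x x'"
    using matching_0[OF assms] subset_adjoin[of R x x']
    unfolding adjoin_products_def by (cases p) force
qed

lemma matching_adjoin_products:
  assumes R: "matching R" and Z: "matching Z"
    and eq_0: "\<And>z z'. (z, z') \<in> adjoin_products R Z x x' \<Longrightarrow> z = 0 \<longleftrightarrow> z' = 0"
  shows "matching (adjoin_products R Z x x')"
  unfolding matching_def
proof (intro conjI allI impI)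
  show "(0, 0) \<in> adjoin_products R Z x x'"
    using subset_adjoin_products[OF R] matching_0[OF Z] by blast
  fix a a' b b' assume "(a, a') \<in> adjoin_products R Z x x'" "(b, b') \<in> adjoin_products R Z x x'"
  then obtain z1 z1' b1 b1' c1 c1' z2 z2' b2 b2' c2 c2'
    where 1: "(z1, z1') \<in> Z" "(b1, b1') \<in> adjoin R x x'" "(c1, c1') \<in> R"
      and 2: "(z2, z2') \<in> Z" "(b2, b2') \<in> adjoin R x x'" "(c2, c2') \<in> R"
      and a: "a = z1 + outer x b1 + outer c1 x" "a' = z1' + outer x' b1' + outer c1' x'"
      and b: "b = z2 + outer x b2 + outer c2 x" "b' = z2' + outer x' b2' + outer c2' x'"
    unfolding adjoin_products_def by blast
  have "a + b = (z1 + z2) + outer x (b1 + b2) + outer (c1 + c2) x"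
    "a' + b' = (z1' + z2') + outer x' (b1' + b2') + outer (c1' + c2') x'"
    by (simp_all only: a b outer_add_left outer_add_right ac_simps)
  then show "(a + b, a' + b') \<in> adjoin_products R Z x x'"
    unfolding adjoin_products_def
    using matching_add[OF Z 1(1) 2(1)] matching_add[OF R 1(3) 2(3)]
      adjoin_closed[OF R vec_add_self vec_add_self 1(2) 2(2)] by blast
qed (use eq_0 in blast)+

lemma outer_adjoin:
  fixes R :: "(vec \<times> vec) set"
  assumes R: "matching R" and Z: "matching Z"
    and RZ: "\<And>a a' b b'. (a, a') \<in> R \<Longrightarrow> (b, b') \<in> R \<Longrightarrow> (outer a b, outer a' b') \<in> Z"
    and a: "(a, a') \<in> adjoin R x x'" and b: "(b, b') \<in> adjoin R x x'"
  shows "(outer a b, outer a' b') \<in> adjoin_products R Z x x'"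
proof -
  obtain c c' where c: "(c, c') \<in> R" "(a, a') = (c, c') \<or> (a, a') = (c + x, c' + x')"
    using a by (auto simp: adjoin_def)
  obtain d d' where d: "(d, d') \<in> R" "(b, b') = (d, d') \<or> (b, b') = (d + x, d' + x')"
    using b by (auto simp: adjoin_def)
  have 0: "(0, 0) \<in> R" "(0, 0) \<in> adjoin R x x'"
    using matching_0[OF R] subset_adjoin[of R x x'] by auto
  have mem: "(outer c d + outer x e + outer f x, outer c' d' + outer x' e' + outer f' x')
      \<in> adjoin_products R Z x x'"
    if "(e, e') \<in> adjoin R x x'" "(f, f') \<in> R" for e e' f f'
    using RZ[OF c(1) d(1)] that unfolding adjoin_products_def by blast
  from c(2) show ?thesis
  proof
    assume A: "(a, a') = (c, c')"
    from d(2) show ?thesis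
      using mem[OF 0(2) 0(1)] mem[OF 0(2) c(1)] A by (auto simp: outer_add_right)
  next
    assume A: "(a, a') = (c + x, c' + x')"
    from d(2) show ?thesis
      using mem[OF b 0(1)] mem[OF b c(1)] A
      by (auto simp: outer_add_left outer_add_right ac_simps)
  qed
qed

text \<open>
  Any two vectors that are not yet matched may be matched with each other: a linear map on vectors
  induces one on sums of outer products, and \<open>low_rank_controlled\<close> keeps the other matched matrices
  out of its way.
\<close>

lemma position_add_vector:
  assumes pos: "position n E E' (K + 2) M R Z" and E: "contains_square n E" "contains_square n E'"
    and x: "x \<in> vecs n" and M: "M < 2 ^ n"
  shows "\<exists>R' Z'. R \<subseteq> R' \<and> Z \<subseteq> Z' \<and> position n E E' K (grow M) R' Z' \<and> x \<in> Domain R'"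
proof (cases "x \<in> Domain R")
  case True
  moreover have "position n E E' K (grow M) R Z"
    by (rule position_mono[OF pos]) (use le_grow[of M] in auto)
  ultimately show ?thesis by blast
next
  case False
  have fin: "finite R" "finite Z" using position_finite[OF pos] E by (auto simp: contains_square_def)
  have R: "R \<subseteq> vecs n \<times> vecs n" "matching R" and Z: "Z \<subseteq> mats E \<times> mats E'" "matching Z"
    and RZ: "\<And>a a' b b'. (a, a') \<in> R \<Longrightarrow> (b, b') \<in> R \<Longrightarrow> (outer a b, outer a' b') \<in> Z"
    and refl: "low_rank_controlled n (K + 2) R Z" "low_rank_controlled n (K + 2) (R\<inverse>) (Z\<inverse>)"
    and card: "card R \<le> M" "card Z \<le> M"
    using pos unfolding position_def by blast+
  obtain x' where x': "x' \<in> vecs n" "x' \<notin> Range R"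
    using exists_vec_outside[OF fin(1)] card(1) M by (meson le_less_trans)
  have inv: "R\<inverse> \<subseteq> vecs n \<times> vecs n" "matching (R\<inverse>)" "matching (Z\<inverse>)" "x' \<notin> Domain (R\<inverse>)"
    using R Z x' by (auto intro: matching_converse)
  note half = adjoin_products_half[OF R Z(2) refl(1) x False, where x' = x']
  note half' = adjoin_products_half[OF inv(1-3) refl(2) x'(1) inv(4), where x' = x,
      folded adjoin_converse adjoin_products_converse, unfolded converse_iff]
  let ?R = "adjoin R x x'" and ?Z = "adjoin_products R Z x x'"
  have vec: "?R \<subseteq> vecs n \<times> vecs n"
    using R(1) x x'(1) by (auto simp: adjoin_def vecs_add)
  have "matching ?R"
    unfolding matching_def
    using adjoin_closed[OF R(2) vec_add_self vec_add_self] matching_0[OF R(2)] subset_adjoin[of R x x']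
      half(3) half'(3) by blast
  moreover have "matching ?Z"
    using matching_adjoin_products[OF R(2) Z(2)] half(1) half'(1) by blast
  moreover have "?Z \<subseteq> mats E \<times> mats E'"
  proof -
    have "outer a b \<in> mats E" "outer a b \<in> mats E'" if "a \<in> vecs n" "b \<in> vecs n" for a b
      using that E outer_in_mats by (auto simp: contains_square_def)
    then show ?thesis
      using R(1) Z(1) x x'(1) vec unfolding adjoin_products_def
      by (auto intro!: mats_add)
  qed
  moreover have "card ?R \<le> grow M"
    using card_adjoin(2)[OF fin(1), of x x'] card(1) le_grow[of M] by simp
  moreover have "card ?Z \<le> grow M"
  proof -
    have "card ?Z \<le> card Z * (2 * card R * card R)"
      by (rule card_adjoin_products[OF fin])
    also have "\<dots> \<le> M * (2 * M * M)"
      using card by (intro mult_le_mono) auto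
    finally show ?thesis by (simp add: grow_def power3_eq_cube)
  qed
  ultimately have "position n E E' K (grow M) ?R ?Z"
    unfolding position_def
    using vec outer_adjoin[OF R(2) Z(2) RZ] half(2) half'(2) by blast
  moreover have "x \<in> Domain ?R"
    using matching_0[OF R(2)] by (force simp: adjoin_def)
  ultimately show ?thesis
    using subset_adjoin[of R] subset_adjoin_products[OF R(2), of Z]
    by (intro exI[of _ ?R] exI[of _ ?Z] conjI)
qed

lemma position_add_vectors:
  assumes "contains_square n E" "contains_square n E'"
  assumes "position n E E' (K + 2 * length xs) M R Z" "set xs \<subseteq> vecs n"
    and "(grow ^^ length xs) M \<le> n"
  shows "\<exists>R' Z'. R \<subseteq> R' \<and> Z \<subseteq> Z' \<and> position n E E' K ((grow ^^ length xs) M) R' Z'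
    \<and> set xs \<subseteq> Domain R'"
  using assms(3-)
proof (induction xs arbitrary: M R Z)
  case Nil
  then show ?case by auto
next
  case (Cons x xs)
  have "M \<le> n" using le_grow_pow Cons.prems(3) by (rule order_trans)
  then have M: "M < 2 ^ n" using less_exp[of n] by linarith
  have pos: "position n E E' (K + 2 * length xs + 2) M R Z" and x: "x \<in> vecs n"
    using Cons.prems by simp_all
  obtain R1 Z1 where 1: "R \<subseteq> R1" "Z \<subseteq> Z1" "x \<in> Domain R1"
    "position n E E' (K + 2 * length xs) (grow M) R1 Z1"
    using position_add_vector[OF pos assms(1,2) x M] by blast
  have "(grow ^^ length xs) (grow M) \<le> n"
    using Cons.prems(3) by (simp add: funpow_swap1)
  then obtain R2 Z2 where 2: "R1 \<subseteq> R2" "Z1 \<subseteq> Z2" "set xs \<subseteq> Domain R2"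
    "position n E E' K ((grow ^^ length xs) (grow M)) R2 Z2"
    using Cons.IH[OF 1(4)] Cons.prems(2) by auto
  have "x \<in> Domain R2" using 1(3) 2(1) by blast
  then show ?case
    using 1 2 by (intro exI[of _ R2] exI[of _ Z2]) (auto simp: funpow_swap1)
qed

lemma low_rank_spanned:
  assumes "w \<in> low_rank n k"
  shows "\<exists>xs. length xs = 2 * k \<and> set xs \<subseteq> vecs n
    \<and> (\<forall>E E' K M R Z. position n E E' K M R Z \<longrightarrow> set xs \<subseteq> Domain R \<longrightarrow> w \<in> Domain Z)"
  using assms
proof (induction k arbitrary: w)
  case 0
  then show ?case
  proof (intro exI[of _ "[]"] conjI allI impI)
    fix E E' K M R Z assume "position n E E' K M R Z"
    then have "0 \<in> Domain Z" unfolding position_def using Domain_closed(1) by blast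
    then show "w \<in> Domain Z" using 0 unfolding low_rank.simps by blast
  qed simp_all
next
  case (Suc k)
  then obtain y a b where y: "y \<in> low_rank n k" and ab: "a \<in> vecs n" "b \<in> vecs n"
    and w: "w = y + outer a b" by auto
  obtain xs where xs: "length xs = 2 * k" "set xs \<subseteq> vecs n"
    "\<And>E E' K M R Z. position n E E' K M R Z \<Longrightarrow> set xs \<subseteq> Domain R \<Longrightarrow> y \<in> Domain Z"
    using Suc.IH[OF y] by blast
  have "w \<in> Domain Z"
    if pos: "position n E E' K M R Z" and sub: "set (a # b # xs) \<subseteq> Domain R" for E E' K M R Z
  proof -
    have Z: "matching Z" using pos by (simp add: position_def)
    have "y \<in> Domain Z" using xs(3)[OF pos] sub by simp
    moreover have "outer a b \<in> Domain Z"
      using sub pos unfolding position_def by (simp add: Domain_iff) blast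
    ultimately show ?thesis unfolding w by (rule Domain_closed[OF Z])
  qed
  then show ?case
    using xs ab by (intro exI[of _ "a # b # xs"]) auto
qed

text \<open>
  There are \<open>2 ^ (n * n)\<close> matrices in the square alone, but at most \<open>2 ^ (2 * n * K)\<close> within distance \<open>K\<close>
  of each of boundedly many matched ones. The existence of a matrix far from everything follows by counting.
\<close>

lemma exists_mat_far:
  assumes "contains_square n E'" "finite Z" "card Z * 2 ^ (2 * n * K) < 2 ^ (n * n)"
  shows "\<exists>z'\<in>mats E'. \<forall>y\<in>Range Z. y + z' \<notin> low_rank n K"
proof (rule ccontr)
  assume not: "\<not> ?thesis"
  \<comment> \<open>The matrices within distance \<open>K\<close> of the matched ones on the right.\<close>
  let ?near = "(\<lambda>(p, w). snd p + w) ` (Z \<times> low_rank n K)"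
  have "mats E' \<subseteq> ?near"
  proof
    fix z' assume "z' \<in> mats E'"
    then obtain y where "y \<in> Range Z" "y + z' \<in> low_rank n K" using not by blast
    moreover from this obtain x where "(x, y) \<in> Z" by blast
    ultimately show "z' \<in> ?near"
      by (intro image_eqI[where x = "((x, y), y + z')"]) (simp_all add: mat_add_cancel)
  qed
  moreover have "finite (Z \<times> low_rank n K)"
    using assms(2) finite_low_rank by simp
  ultimately have "card (mats E') \<le> card (Z \<times> low_rank n K)"
    by (rule surj_card_le[rotated])
  also have "\<dots> \<le> card Z * 2 ^ (2 * n * K)"
    by (simp add: card_cartesian_product card_low_rank)
  also have "\<dots> < 2 ^ (n * n)" by fact
  also have "\<dots> \<le> 2 ^ card E'"
    using card_mono[of E' "{..<n} \<times> {..<n}"] assms(1)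
    by (simp add: contains_square_def card_cartesian_product)
  also have "\<dots> = card (mats E')"
    using assms(1) by (simp add: card_mats contains_square_def)
  finally show False by simp
qed

lemma adjoin_mat_half:
  assumes Z: "matching Z" and R: "low_rank_controlled n K R Z"
    and far: "\<And>y. y \<in> Domain Z \<Longrightarrow> y + z \<notin> low_rank n K"
  shows "\<And>a a'. (a, a') \<in> adjoin Z z z' \<Longrightarrow> a = 0 \<Longrightarrow> a' = 0"
    and "low_rank_controlled n K R (adjoin Z z z')"
proof -
  show "a' = 0" if "(a, a') \<in> adjoin Z z z'" "a = 0" for a a'
    using that matching_eq_0[OF Z] far zero_low_rank[of n K] unfolding adjoin_def
    by (auto dest: DomainI) (metis DomainI)
  show "low_rank_controlled n K R (adjoin Z z z')"
    using R far unfolding low_rank_controlled_def adjoin_def by blast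
qed

text \<open>
  A matrix at distance more than \<open>K\<close> from all matched ones is answered by another such matrix, whether
  or not it is a sum of outer products. The enlarged relation contains no new matrices of rank at most
  \<open>K\<close>, so there is nothing to verify for these.
\<close>

lemma position_add_far_matrix:
  assumes pos: "position n E E' K M R Z" and E: "contains_square n E" "contains_square n E'"
    and z: "z \<in> mats E" and far: "\<And>y. y \<in> Domain Z \<Longrightarrow> y + z \<notin> low_rank n K"
    and n: "M + 2 * K + 1 \<le> n"
  shows "\<exists>Z'. Z \<subseteq> Z' \<and> position n E E' K (grow M) R Z' \<and> z \<in> Domain Z'"
proof -
  have fin: "finite R" "finite Z" using position_finite[OF pos] E by (auto simp: contains_square_def)
  have R: "R \<subseteq> vecs n \<times> vecs n" "matching R" and Z: "Z \<subseteq> mats E \<times> mats E'" "matching Z"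
    and RZ: "\<And>a a' b b'. (a, a') \<in> R \<Longrightarrow> (b, b') \<in> R \<Longrightarrow> (outer a b, outer a' b') \<in> Z"
    and refl: "low_rank_controlled n K R Z" "low_rank_controlled n K (R\<inverse>) (Z\<inverse>)"
    and card: "card R \<le> M" "card Z \<le> M"
    using pos unfolding position_def by blast+
  have "card Z * 2 ^ (2 * n * K) < 2 ^ (n * n)"
  proof -
    have "card Z < 2 ^ M" using card(2) less_exp[of M] by linarith
    then have "card Z * 2 ^ (2 * n * K) < 2 ^ M * 2 ^ (2 * n * K)"
      by simp
    also have "\<dots> = 2 ^ (M + 2 * n * K)" by (simp add: power_add)
    also have "\<dots> \<le> 2 ^ (n * n)"
    proof (rule power_increasing)
      have "M + 2 * n * K \<le> n * M + n * (2 * K)" using n by simp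
      also have "\<dots> \<le> n * n" using n by (simp flip: distrib_left)
      finally show "M + 2 * n * K \<le> n * n" .
    qed simp
    finally show ?thesis .
  qed
  then obtain z' where z': "z' \<in> mats E'" "\<And>y. y \<in> Range Z \<Longrightarrow> y + z' \<notin> low_rank n K"
    using exists_mat_far[OF E(2) fin(2)] by blast
  note half = adjoin_mat_half[OF Z(2) refl(1) far, where z' = z']
  have far': "\<And>y. y \<in> Domain (Z\<inverse>) \<Longrightarrow> y + z' \<notin> low_rank n K"
    using z'(2) by auto
  note half' = adjoin_mat_half[OF matching_converse[OF Z(2)] refl(2) far', where z' = z,
      folded adjoin_converse, unfolded converse_iff]
  let ?Z = "adjoin Z z z'"
  have "matching ?Z"
    unfolding matching_def
    using adjoin_closed[OF Z(2) mat_add_self mat_add_self] matching_0[OF Z(2)] subset_adjoin[of Z z z']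
      half(1) half'(1) by blast
  moreover have "?Z \<subseteq> mats E \<times> mats E'"
    using Z(1) z z'(1) by (auto simp: adjoin_def mats_add)
  moreover have "card ?Z \<le> grow M" "card R \<le> grow M"
    using card_adjoin(2)[OF fin(2), of z z'] card le_grow[of M] by simp_all
  ultimately have "position n E E' K (grow M) R ?Z"
    unfolding position_def
    using R RZ subset_adjoin[of Z z z'] half(2) half'(2) by blast
  moreover have "z \<in> Domain ?Z"
    using matching_0[OF Z(2)] by (force simp: adjoin_def)
  ultimately show ?thesis
    using subset_adjoin[of Z] by (intro exI[of _ ?Z] conjI)
qed

text \<open>
  A matrix \<open>z\<close> at distance at most \<open>k\<close> from a matched one becomes matched as soon as the \<open>2 * k\<close> vectors
  occurring in the difference are.
\<close>

lemma position_add_near_matrix: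
  assumes pos: "position n E E' (K + 4 * k) M R Z" and E: "contains_square n E" "contains_square n E'"
    and y: "y \<in> Domain Z" "y + z \<in> low_rank n k"
    and n: "(grow ^^ (2 * k)) M \<le> n"
  shows "\<exists>R' Z'. R \<subseteq> R' \<and> Z \<subseteq> Z' \<and> position n E E' K ((grow ^^ (2 * k)) M) R' Z' \<and> z \<in> Domain Z'"
proof -
  obtain xs where xs: "length xs = 2 * k" "set xs \<subseteq> vecs n"
    "\<And>E E' K M R Z. position n E E' K M R Z \<Longrightarrow> set xs \<subseteq> Domain R \<Longrightarrow> y + z \<in> Domain Z"
    using low_rank_spanned[OF y(2)] by blast
  obtain R' Z' where R': "R \<subseteq> R'" "Z \<subseteq> Z'"
    and pos': "position n E E' K ((grow ^^ (2 * k)) M) R' Z'" "set xs \<subseteq> Domain R'"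
    using position_add_vectors[OF E, of K xs M R Z] pos xs(1,2) n by auto
  have "matching Z'" using pos'(1) by (simp add: position_def)
  moreover have "y \<in> Domain Z'" using y(1) R' by blast
  ultimately have "y + (y + z) \<in> Domain Z'"
    using xs(3)[OF pos'] by (rule Domain_closed(2))
  then have "z \<in> Domain Z'" by (simp only: mat_add_cancel)
  then show ?thesis using R' pos' by blast
qed

text \<open>
  The functions \<open>\<kappa>\<close> and \<open>\<nu>\<close> prescribe how much rank control and how large a dimension the rest of the game
  needs, depending on the size of the position. The threshold \<open>k\<close> between near and far has to be the
  control needed after the far reply, whose size does not depend on \<open>k\<close>; only then is the size \<open>M1\<close>
  after the near reply determined, and with it the control needed at the start.
\<close>

lemma position_add_matrix:
  fixes \<kappa> \<nu> :: "nat \<Rightarrow> nat"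
  shows "\<exists>K N. \<forall>n\<ge>N. \<forall>E E' R Z z. contains_square n E \<longrightarrow> contains_square n E' \<longrightarrow> position n E E' K M R Z \<longrightarrow> z \<in> mats E
    \<longrightarrow> (\<exists>R' Z' M'. R \<subseteq> R' \<and> Z \<subseteq> Z' \<and> z \<in> Domain Z' \<and> position n E E' (\<kappa> M') M' R' Z' \<and> \<nu> M' \<le> n)"
proof -
  define k where "k = \<kappa> (grow M)"
  define M1 where "M1 = (grow ^^ (2 * k)) M"
  define K where "K = k + (\<kappa> M1 + 4 * k)"
  define N where "N = (M + 2 * k + 1) + M1 + \<nu> M1 + \<nu> (grow M)"
  have step: "\<exists>R' Z' M'. R \<subseteq> R' \<and> Z \<subseteq> Z' \<and> z \<in> Domain Z' \<and> position n E E' (\<kappa> M') M' R' Z' \<and> \<nu> M' \<le> n"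
    if n: "n \<ge> N" and E: "contains_square n E" "contains_square n E'" and pos: "position n E E' K M R Z"
      and z: "z \<in> mats E" for n E E' R Z z
  proof (cases "\<exists>y\<in>Domain Z. y + z \<in> low_rank n k")
    case True
    then obtain y where y: "y \<in> Domain Z" "y + z \<in> low_rank n k" by blast
    have pos': "position n E E' (\<kappa> M1 + 4 * k) M R Z"
      by (rule position_mono[OF pos]) (simp_all add: K_def)
    have M1: "M1 \<le> n" and \<nu>: "\<nu> M1 \<le> n"
      using n by (simp_all add: N_def)
    obtain R' Z' where "R \<subseteq> R'" "Z \<subseteq> Z'" "position n E E' (\<kappa> M1) M1 R' Z'" "z \<in> Domain Z'"
      using position_add_near_matrix[OF pos' E y, folded M1_def, OF M1] by blast
    then show ?thesis
      using \<nu> by (intro exI[of _ R'] exI[of _ Z'] exI[of _ M1] conjI)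
  next
    case False
    then have far: "y + z \<notin> low_rank n k" if "y \<in> Domain Z" for y using that by blast
    have pos': "position n E E' k M R Z"
      by (rule position_mono[OF pos]) (simp_all add: K_def)
    have M: "M + 2 * k + 1 \<le> n" and \<nu>: "\<nu> (grow M) \<le> n"
      using n by (simp_all add: N_def)
    obtain Z' where "Z \<subseteq> Z'" "position n E E' (\<kappa> (grow M)) (grow M) R Z'" "z \<in> Domain Z'"
      using position_add_far_matrix[OF pos' E z far M] unfolding k_def by blast
    then show ?thesis
      using \<nu> by (intro exI[of _ R] exI[of _ Z'] exI[of _ "grow M"] conjI subset_refl)
  qed
  show ?thesis by (rule exI[of _ K], rule exI[of _ N], intro allI impI, rule step)
qed

section \<open>The groups\<close>

text \<open>
  The five points moved by the alternating group. A constant of its own keeps simplification from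
  rewriting the interval.
\<close>

definition points :: "nat set" where
  "points = {1..5}"

lemma finite_points: "finite points"
  by (simp add: points_def)

definition pairing :: "(nat \<Rightarrow> vec) \<Rightarrow> (nat \<Rightarrow> vec) \<Rightarrow> mat" where
  "pairing u w = (\<Sum>j\<in>points. outer (u j) (w j))"

text \<open>
  Five-tuples with sum zero. The sum has to vanish because otherwise it would survive in the
  abelianisation; and no fixed vectors are left in the tuples, since five is odd.
\<close>

definition tuples :: "nat \<Rightarrow> (nat \<Rightarrow> vec) set" where
  "tuples n = {u. (\<forall>j. u j \<in> vecs n) \<and> (\<forall>j. j \<notin> points \<longrightarrow> u j = 0) \<and> (\<Sum>j\<in>points. u j) = 0}"

type_synonym element = "(nat \<Rightarrow> nat) \<times> (nat \<Rightarrow> vec) \<times> (nat \<Rightarrow> vec) \<times> mat"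

text \<open>
  The semidirect product of the alternating group on five letters, acting by permuting the entries of
  the tuples, with a group of Heisenberg type: the pairs \<open>(u, w)\<close> of tuples, extended centrally by the
  matrices \<open>z\<close> by means of the cocycle \<open>pairing\<close>.
\<close>

definition heis :: "nat \<Rightarrow> (nat \<times> nat) set \<Rightarrow> element monoid" where
  "heis n E = \<lparr>carrier = carrier (alt_group 5) \<times> tuples n \<times> tuples n \<times> mats E,
     monoid.mult = (\<lambda>(s, u, w, z) (s', u', w', z').
       (s \<circ> s', (u \<circ> s') + u', (w \<circ> s') + w', z + z' + pairing (u \<circ> s') w')),
     one = (id, 0, 0, 0)\<rparr>"

lemma heis_mult: "(s, u, w, z) \<otimes>\<^bsub>heis n E\<^esub> (s', u', w', z')
    = (s \<circ> s', (u \<circ> s') + u', (w \<circ> s') + w', z + z' + pairing (u \<circ> s') w')"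
  by (simp add: heis_def)

lemma heis_one: "\<one>\<^bsub>heis n E\<^esub> = (id, 0, 0, 0)"
  by (simp add: heis_def)

lemma heis_carrier: "carrier (heis n E) = carrier (alt_group 5) \<times> tuples n \<times> tuples n \<times> mats E"
  by (simp add: heis_def)

lemma pairing_add_left: "pairing (u + v) w = pairing u w + pairing v w"
  and pairing_add_right: "pairing u (v + w) = pairing u v + pairing u w"
  by (simp_all only: pairing_def plus_fun_apply outer_add_left outer_add_right sum.distrib)

lemma pairing_0: "pairing 0 w = 0" "pairing u 0 = 0"
  by (simp_all only: pairing_def zero_fun_apply outer_0_left outer_0_right sum.neutral_const)

lemma comp_add: "(u + v) \<circ> s = (u \<circ> s) + (v \<circ> s)"
  by (simp add: fun_eq_iff)

lemma comp_0: "0 \<circ> s = 0"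
  by (simp add: fun_eq_iff)

text \<open>
  Invariance of the cocycle under the alternating group; this is what makes the multiplication
  associative.
\<close>

lemma pairing_permute:
  assumes "s permutes points"
  shows "pairing (u \<circ> s) (w \<circ> s) = pairing u w"
  using sum.permute[OF assms, of "\<lambda>j. outer (u j) (w j)"]
  unfolding pairing_def o_def by (rule sym)

lemma tuples_0: "0 \<in> tuples n"
  unfolding tuples_def by (simp add: vecs_def)

lemma tuples_add: "u \<in> tuples n \<Longrightarrow> v \<in> tuples n \<Longrightarrow> u + v \<in> tuples n"
  unfolding tuples_def by (simp add: vecs_add sum.distrib)

lemma tuples_permute:
  assumes s: "s permutes points" and u: "u \<in> tuples n"
  shows "u \<circ> s \<in> tuples n"
proof -
  have "(\<Sum>j\<in>points. (u \<circ> s) j) = (\<Sum>j\<in>points. u j)"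
    using sum.permute[OF s, of u] by (simp add: o_def)
  then show ?thesis
    using u permutes_in_image[OF s] unfolding tuples_def by simp
qed

lemma sum_in_mats: "(\<And>i. i \<in> I \<Longrightarrow> f i \<in> mats E) \<Longrightarrow> sum f I \<in> mats E"
  by (induction I rule: infinite_finite_induct) (auto intro: mats_0 mats_add)

lemma pairing_in_mats:
  assumes "contains_square n E" "u \<in> tuples n" "w \<in> tuples n"
  shows "pairing u w \<in> mats E"
  unfolding pairing_def
  by (rule sum_in_mats, rule outer_in_mats[of n]) (use assms in \<open>auto simp: contains_square_def tuples_def\<close>)

lemma alt_group_permutes: "s \<in> carrier (alt_group 5) \<Longrightarrow> s permutes points"
  by (simp add: alt_group_carrier points_def)

lemma tuples_add_self: "(u :: nat \<Rightarrow> vec) + u = 0"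
  by (rule mat_add_self)

lemma heis_group:
  assumes E: "contains_square n E"
  shows "group (heis n E)"
proof -
  interpret A: group "alt_group 5" by (rule alt_group_is_group)
  note A_mult = A.m_closed[unfolded alt_group_mult]
  show ?thesis
  proof (rule groupI)
    fix g h assume "g \<in> carrier (heis n E)" "h \<in> carrier (heis n E)"
    then show "g \<otimes>\<^bsub>heis n E\<^esub> h \<in> carrier (heis n E)"
      by (cases g; cases h)
        (simp add: heis_carrier heis_mult A_mult tuples_add tuples_permute alt_group_permutes
          mats_add pairing_in_mats[OF E])
  next
    show "\<one>\<^bsub>heis n E\<^esub> \<in> carrier (heis n E)"
      using A.one_closed by (simp add: heis_one heis_carrier tuples_0 mats_0 alt_group_one)
  next
    fix g h k assume g: "g \<in> carrier (heis n E)" "h \<in> carrier (heis n E)" "k \<in> carrier (heis n E)"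
    obtain s u w z where gg: "g = (s, u, w, z)" by (cases g)
    obtain s' u' w' z' where hh: "h = (s', u', w', z')" by (cases h)
    obtain t v x y where kk: "k = (t, v, x, y)" by (cases k)
    have "t permutes points" using g kk by (simp add: heis_carrier alt_group_permutes)
    then have "pairing (u \<circ> (s' \<circ> t)) (w' \<circ> t) = pairing (u \<circ> s') w'"
      using pairing_permute[of t "u \<circ> s'" w'] by (simp add: o_assoc)
    then show "g \<otimes>\<^bsub>heis n E\<^esub> h \<otimes>\<^bsub>heis n E\<^esub> k = g \<otimes>\<^bsub>heis n E\<^esub> (h \<otimes>\<^bsub>heis n E\<^esub> k)"
      by (simp only: gg hh kk heis_mult comp_add pairing_add_left pairing_add_right o_assoc ac_simps)
  next
    fix g assume "g \<in> carrier (heis n E)"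
    then show "\<one>\<^bsub>heis n E\<^esub> \<otimes>\<^bsub>heis n E\<^esub> g = g"
      by (cases g) (simp only: heis_one heis_mult comp_0 pairing_0 id_o add_0 add_0_right)
  next
    fix g assume g: "g \<in> carrier (heis n E)"
    obtain s u w z where gg: "g = (s, u, w, z)" by (cases g)
    have s: "s \<in> carrier (alt_group 5)" using g gg by (simp add: heis_carrier)
    define t where "t = inv\<^bsub>alt_group 5\<^esub> s"
    have t: "t \<in> carrier (alt_group 5)" "t \<circ> s = id"
      using A.inv_closed[OF s] A.l_inv[OF s] by (simp_all add: t_def alt_group_mult alt_group_one)
    have ts: "v \<circ> t \<circ> s = v" for v :: "nat \<Rightarrow> vec" using t(2) by (simp flip: o_assoc)
    have "(t, u \<circ> t, w \<circ> t, z + pairing u w) \<in> carrier (heis n E)"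
      using g t(1) by (simp add: gg heis_carrier tuples_permute alt_group_permutes mats_add
          pairing_in_mats[OF E])
    moreover have "(t, u \<circ> t, w \<circ> t, z + pairing u w) \<otimes>\<^bsub>heis n E\<^esub> g = \<one>\<^bsub>heis n E\<^esub>"
    proof -
      have "z + pairing u w + z + pairing u w = (z + z) + (pairing u w + pairing u w)"
        by (simp only: ac_simps)
      then show ?thesis
        by (simp only: gg heis_mult heis_one ts t(2) tuples_add_self mat_add_self add_0)
    qed
    ultimately show "\<exists>h\<in>carrier (heis n E). h \<otimes>\<^bsub>heis n E\<^esub> g = \<one>\<^bsub>heis n E\<^esub>" by blast
  qed
qed

lemma finite_tuples: "finite (tuples n)"
proof (rule finite_subset)
  show "tuples n \<subseteq> {u. \<forall>j. (j \<in> points \<longrightarrow> u j \<in> vecs n) \<and> (j \<notin> points \<longrightarrow> u j = 0)}"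
    by (auto simp: tuples_def)
  show "finite {u. \<forall>j. (j \<in> points \<longrightarrow> u j \<in> vecs n) \<and> (j \<notin> points \<longrightarrow> u j = 0)}"
    by (rule finite_set_of_finite_funs) (simp_all add: finite_vecs finite_points)
qed

lemma heis_finite:
  assumes "contains_square n E" shows "finite (carrier (heis n E))"
proof -
  have "finite (carrier (alt_group 5))"
    by (rule finite_subset[OF _ finite_permutations[OF finite_points]]) (auto dest: alt_group_permutes)
  then show ?thesis
    using assms by (simp add: heis_carrier finite_tuples finite_mats contains_square_def)
qed

section \<open>The game on the groups\<close>

text \<open>
  An element is made of ten vectors and a matrix, and the multiplication uses only sums and outer
  products of these. So positions induce partial isomorphisms of the groups.
\<close>

definition related :: "(vec \<times> vec) set \<Rightarrow> (mat \<times> mat) set \<Rightarrow> element \<Rightarrow> element \<Rightarrow> bool" where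
  "related R Z = (\<lambda>(s, u, w, z) (s', u', w', z').
     s' = s \<and> (\<forall>j. (u j, u' j) \<in> R) \<and> (\<forall>j. (w j, w' j) \<in> R) \<and> (z, z') \<in> Z)"

lemma related_converse: "related (R\<inverse>) (Z\<inverse>) g' g \<longleftrightarrow> related R Z g g'"
  by (cases g; cases g') (auto simp: related_def)

lemma related_mono: "related R Z g g' \<Longrightarrow> R \<subseteq> R' \<Longrightarrow> Z \<subseteq> Z' \<Longrightarrow> related R' Z' g g'"
  by (cases g; cases g') (auto simp: related_def)

lemma related_mult:
  assumes pos: "position n E E' K M R Z" and "related R Z g g'" "related R Z h h'"
  shows "related R Z (g \<otimes>\<^bsub>heis n E\<^esub> h) (g' \<otimes>\<^bsub>heis n E'\<^esub> h')"
proof -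
  have R: "matching R" and Z: "matching Z"
    and RZ: "\<And>a a' b b'. (a, a') \<in> R \<Longrightarrow> (b, b') \<in> R \<Longrightarrow> (outer a b, outer a' b') \<in> Z"
    using pos unfolding position_def by blast+
  obtain s u w z where g: "g = (s, u, w, z)" by (cases g)
  obtain u' w' z' where g': "g' = (s, u', w', z')"
    using assms(2) by (cases g') (simp add: g related_def)
  obtain t v x y where h: "h = (t, v, x, y)" by (cases h)
  obtain v' x' y' where h': "h' = (t, v', x', y')"
    using assms(3) by (cases h') (simp add: h related_def)
  have rel: "\<And>j. (u j, u' j) \<in> R" "\<And>j. (w j, w' j) \<in> R" "(z, z') \<in> Z"
    "\<And>j. (v j, v' j) \<in> R" "\<And>j. (x j, x' j) \<in> R" "(y, y') \<in> Z"
    using assms(2,3) by (simp_all add: g g' h h' related_def)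
  have "(pairing (u \<circ> t) x, pairing (u' \<circ> t) x') \<in> Z"
    unfolding pairing_def o_def by (rule matching_sum[OF Z]) (rule RZ rel)+
  then show ?thesis
    unfolding g g' h h' heis_mult related_def
    using rel by (simp add: matching_add[OF R] matching_add[OF Z])
qed

lemma related_one:
  assumes "position n E E' K M R Z"
  shows "related R Z \<one>\<^bsub>heis n E\<^esub> \<one>\<^bsub>heis n E'\<^esub>"
  using assms matching_0[of R] matching_0[of Z] unfolding position_def related_def heis_one
  by simp

lemma related_eq_iff:
  assumes pos: "position n E E' K M R Z" and "related R Z g g'" "related R Z h h'"
  shows "g = h \<longleftrightarrow> g' = h'"
proof -
  have R: "matching R" and Z: "matching Z"
    using pos unfolding position_def by blast+
  obtain s u w z where g: "g = (s, u, w, z)" by (cases g)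
  obtain u' w' z' where g': "g' = (s, u', w', z')"
    using assms(2) by (cases g') (simp add: g related_def)
  obtain t v x y where h: "h = (t, v, x, y)" by (cases h)
  obtain v' x' y' where h': "h' = (t, v', x', y')"
    using assms(3) by (cases h') (simp add: h related_def)
  have rel: "\<And>j. (u j, u' j) \<in> R" "\<And>j. (w j, w' j) \<in> R" "(z, z') \<in> Z"
    "\<And>j. (v j, v' j) \<in> R" "\<And>j. (x j, x' j) \<in> R" "(y, y') \<in> Z"
    using assms(2,3) by (simp_all add: g g' h h' related_def)
  have "u j = v j \<longleftrightarrow> u' j = v' j" "w j = x j \<longleftrightarrow> w' j = x' j" for j
    using matching_eq_iff[OF R vec_add_eq_0_iff] rel by blast+
  then have "u = v \<longleftrightarrow> u' = v'" "w = x \<longleftrightarrow> w' = x'"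
    by (simp_all only: fun_eq_iff[of u] fun_eq_iff[of u'] fun_eq_iff[of w] fun_eq_iff[of w'])
  moreover have "z = y \<longleftrightarrow> z' = y'"
    using matching_eq_iff[OF Z mat_add_eq_0_iff rel(3,6)] .
  ultimately show ?thesis by (simp add: g g' h h')
qed

text \<open>
  In a finite group the inverse is a power, and one exponent works for both groups.
\<close>

lemma related_inv:
  assumes pos: "position n E E' K M R Z" and E: "contains_square n E" "contains_square n E'"
    and g: "g \<in> carrier (heis n E)" "g' \<in> carrier (heis n E')" and rel: "related R Z g g'"
  shows "related R Z (inv\<^bsub>heis n E\<^esub> g) (inv\<^bsub>heis n E'\<^esub> g')"
proof -
  interpret G: group "heis n E" by (rule heis_group[OF E(1)])
  interpret H: group "heis n E'" by (rule heis_group[OF E(2)])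
  have pow: "related R Z (g [^]\<^bsub>heis n E\<^esub> k) (g' [^]\<^bsub>heis n E'\<^esub> k)" for k :: nat
    by (induction k) (simp_all add: related_one[OF pos] related_mult[OF pos] rel)
  let ?a = "order (heis n E) * order (heis n E')"
  have pos_orders: "order (heis n E) > 0" "order (heis n E') > 0"
    using heis_finite[OF E(1)] heis_finite[OF E(2)] by (simp_all add: G.order_gt_0_iff_finite H.order_gt_0_iff_finite)
  then obtain k where k: "?a = Suc k" by (metis gr0_conv_Suc nat_0_less_mult_iff)
  have "g [^]\<^bsub>heis n E\<^esub> ?a = \<one>\<^bsub>heis n E\<^esub>"
    using g(1) by (simp add: G.nat_pow_pow[symmetric] G.pow_order_eq_1)
  then have "g [^]\<^bsub>heis n E\<^esub> k \<otimes>\<^bsub>heis n E\<^esub> g = \<one>\<^bsub>heis n E\<^esub>" by (simp add: k)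
  then have 1: "inv\<^bsub>heis n E\<^esub> g = g [^]\<^bsub>heis n E\<^esub> k"
    using g(1) by (intro G.inv_equality) simp_all
  have "g' [^]\<^bsub>heis n E'\<^esub> ?a = (g' [^]\<^bsub>heis n E'\<^esub> order (heis n E')) [^]\<^bsub>heis n E'\<^esub> order (heis n E)"
    using g(2) by (simp add: H.nat_pow_pow mult.commute)
  also have "\<dots> = \<one>\<^bsub>heis n E'\<^esub>"
    using g(2) by (simp add: H.pow_order_eq_1)
  finally have "g' [^]\<^bsub>heis n E'\<^esub> k \<otimes>\<^bsub>heis n E'\<^esub> g' = \<one>\<^bsub>heis n E'\<^esub>" by (simp add: k)
  then have 2: "inv\<^bsub>heis n E'\<^esub> g' = g' [^]\<^bsub>heis n E'\<^esub> k"
    using g(2) by (intro H.inv_equality) simp_all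
  show ?thesis unfolding 1 2 by (rule pow)
qed

lemma related_gterm_val:
  assumes pos: "position n E E' K M R Z" and E: "contains_square n E" "contains_square n E'"
    and e: "range e \<subseteq> carrier (heis n E)" "range e' \<subseteq> carrier (heis n E')"
    and rel: "\<And>i. related R Z (e i) (e' i)"
  shows "related R Z (gterm_val (heis n E) e t) (gterm_val (heis n E') e' t)"
proof (induction t)
  case (Inverse t)
  then show ?case
    using related_inv[OF pos E gterm_val_closed[OF heis_group[OF E(1)] e(1)]
        gterm_val_closed[OF heis_group[OF E(2)] e(2)]] by simp
qed (simp_all add: rel related_one[OF pos] related_mult[OF pos])

text \<open>
  A reply on the coordinates is a reply in the group: sums of matched vectors are matched, so the
  sum of the reply vanishes again, and zero entries are matched with zero.
\<close>

lemma related_partner: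
  assumes pos: "position n E E' K M R Z" and g: "(s, u, w, z) \<in> carrier (heis n E)"
    and dom: "\<And>j. j \<in> points \<Longrightarrow> u j \<in> Domain R" "\<And>j. j \<in> points \<Longrightarrow> w j \<in> Domain R" "z \<in> Domain Z"
  shows "\<exists>g'\<in>carrier (heis n E'). related R Z (s, u, w, z) g'"
proof -
  have R: "matching R" "R \<subseteq> vecs n \<times> vecs n" and Z: "Z \<subseteq> mats E \<times> mats E'"
    using pos unfolding position_def by blast+
  have tuple: "\<exists>v'\<in>tuples n. \<forall>j. (v j, v' j) \<in> R"
    if v: "v \<in> tuples n" and dom: "\<And>j. j \<in> points \<Longrightarrow> v j \<in> Domain R" for v
  proof -
    have "v j \<in> Domain R" for j
    proof (cases "j \<in> points")
      case False
      then have "v j = 0" using v by (simp add: tuples_def)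
      then show ?thesis using Domain_closed(1)[OF R(1)] by simp
    qed (rule dom)
    then obtain v' where v': "\<And>j. (v j, v' j) \<in> R" unfolding Domain_iff by metis
    have zero: "v' j = 0" if "j \<notin> points" for j
      using matching_eq_0[OF R(1) v'[of j]] v that by (simp add: tuples_def)
    have "(\<Sum>j\<in>points. v j, \<Sum>j\<in>points. v' j) \<in> R"
      by (rule matching_sum[OF R(1) v'])
    then have "(\<Sum>j\<in>points. v' j) = 0"
      using matching_eq_0[OF R(1)] v unfolding tuples_def by blast
    then have "v' \<in> tuples n"
      using v' R(2) zero unfolding tuples_def by blast
    then show ?thesis using v' by blast
  qed
  have "u \<in> tuples n" "w \<in> tuples n" using g by (simp_all add: heis_carrier)
  then obtain u' w' where u': "u' \<in> tuples n" "\<And>j. (u j, u' j) \<in> R"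
    and w': "w' \<in> tuples n" "\<And>j. (w j, w' j) \<in> R"
    using tuple[of u] tuple[of w] dom(1,2) by metis
  obtain z' where z': "(z, z') \<in> Z" using dom(3) by blast
  have "(s, u', w', z') \<in> carrier (heis n E')"
    using g u' w' z' Z unfolding heis_carrier by auto
  moreover have "related R Z (s, u, w, z) (s, u', w', z')"
    using u' w' z' by (simp add: related_def)
  ultimately show ?thesis by blast
qed

lemma position_add_element:
  fixes \<kappa> \<nu> :: "nat \<Rightarrow> nat"
  shows "\<exists>K N. \<forall>n\<ge>N. \<forall>E E' R Z g. contains_square n E \<longrightarrow> contains_square n E' \<longrightarrow> position n E E' K M R Z \<longrightarrow> g \<in> carrier (heis n E)
    \<longrightarrow> (\<exists>R' Z' M'. R \<subseteq> R' \<and> Z \<subseteq> Z' \<and> position n E E' (\<kappa> M') M' R' Z' \<and> \<nu> M' \<le> n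
       \<and> (\<exists>g'\<in>carrier (heis n E'). related R' Z' g g'))"
proof -
  define M0 where "M0 = (grow ^^ 10) M"
  obtain K0 N0 where step:
    "\<And>n E E' R Z z. n \<ge> N0 \<Longrightarrow> contains_square n E \<Longrightarrow> contains_square n E' \<Longrightarrow> position n E E' K0 M0 R Z \<Longrightarrow> z \<in> mats E
      \<Longrightarrow> \<exists>R' Z' M'. R \<subseteq> R' \<and> Z \<subseteq> Z' \<and> z \<in> Domain Z' \<and> position n E E' (\<kappa> M') M' R' Z' \<and> \<nu> M' \<le> n"
    using position_add_matrix[of M0 \<kappa> \<nu>] by metis
  have main: "\<exists>R' Z' M'. R \<subseteq> R' \<and> Z \<subseteq> Z' \<and> position n E E' (\<kappa> M') M' R' Z' \<and> \<nu> M' \<le> n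
       \<and> (\<exists>g'\<in>carrier (heis n E'). related R' Z' g g')"
    if n: "N0 + M0 \<le> n" and E: "contains_square n E" "contains_square n E'" and pos: "position n E E' (K0 + 20) M R Z"
      and g: "g \<in> carrier (heis n E)" for n E E' R Z g
  proof -
    obtain s u w z where gg: "g = (s, u, w, z)" by (cases g)
    have mem: "u \<in> tuples n" "w \<in> tuples n" "z \<in> mats E"
      using g by (simp_all add: gg heis_carrier)
    define xs where "xs = map u [1..<6] @ map w [1..<6]"
    have len: "length xs = 10" by (simp add: xs_def)
    have "set xs \<subseteq> vecs n" using mem by (auto simp: xs_def tuples_def)
    moreover have "position n E E' (K0 + 2 * length xs) M R Z" "(grow ^^ length xs) M \<le> n"
      using pos n unfolding len M0_def by simp_all
    ultimately obtain R1 Z1 where 1: "R \<subseteq> R1" "Z \<subseteq> Z1" "position n E E' K0 M0 R1 Z1" "set xs \<subseteq> Domain R1"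
      using position_add_vectors[OF E, of K0 xs M R Z] unfolding len M0_def by metis
    have "N0 \<le> n" using n by simp
    from step[OF this E 1(3) mem(3)] obtain R2 Z2 M2 where 2: "R1 \<subseteq> R2" "Z1 \<subseteq> Z2" "z \<in> Domain Z2"
      "position n E E' (\<kappa> M2) M2 R2 Z2" "\<nu> M2 \<le> n" by metis
    have "u j \<in> Domain R2" "w j \<in> Domain R2" if "j \<in> points" for j
    proof -
      have "j \<in> set [1..<6]" using that by (auto simp: points_def)
      then have "u j \<in> set xs" "w j \<in> set xs" unfolding xs_def by simp_all
      then show "u j \<in> Domain R2" "w j \<in> Domain R2" using 1(4) 2(1) by blast+
    qed
    then have "\<exists>g'\<in>carrier (heis n E'). related R2 Z2 g g'"
      using related_partner[OF 2(4) g[unfolded gg] _ _ 2(3)] unfolding gg by blast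
    then show ?thesis
      using 1(1,2) 2 by (intro exI[of _ R2] exI[of _ Z2] exI[of _ M2]) auto
  qed
  show ?thesis
    by (rule exI[of _ "K0 + 20"], rule exI[of _ "N0 + M0"], intro allI impI, rule main)
qed

text \<open>
  The induction on formulas is about all sizes \<open>M\<close>, since every move enlarges the position, while \<open>K\<close> and
  \<open>N\<close> are found in terms of \<open>M\<close> and the formula.
\<close>

definition agreement :: "gform \<Rightarrow> nat \<Rightarrow> nat \<Rightarrow> nat \<Rightarrow> bool" where
  "agreement p M K N \<longleftrightarrow> (\<forall>n\<ge>N. \<forall>E E' R Z e e'.
     contains_square n E \<longrightarrow> contains_square n E' \<longrightarrow> position n E E' K M R Z
     \<longrightarrow> range e \<subseteq> carrier (heis n E) \<longrightarrow> range e' \<subseteq> carrier (heis n E')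
     \<longrightarrow> (\<forall>i. related R Z (e i) (e' i)) \<longrightarrow> sat (heis n E) e p = sat (heis n E') e' p)"

lemma agreementD:
  assumes "agreement p M K N" "N \<le> n" "contains_square n E" "contains_square n E'" "position n E E' K M R Z"
    "range e \<subseteq> carrier (heis n E)" "range e' \<subseteq> carrier (heis n E')" "\<And>i. related R Z (e i) (e' i)"
  shows "sat (heis n E) e p = sat (heis n E') e' p"
  using assms unfolding agreement_def by blast

lemma agreement_mono:
  assumes "agreement p M K N" "K \<le> K'" "N \<le> N'"
  shows "agreement p M K' N'"
  unfolding agreement_def
proof (intro allI impI, goal_cases)
  case (1 n E E' R Z e e')
  then show ?case
    using agreementD[OF assms(1), of n E E' R Z e e'] position_mono[of n E E' K' M R Z K M] assms(2,3)
    by auto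
qed

text \<open>
  One move of the game. By symmetry of positions it suffices that a witness on the left yields a witness
  on the right.
\<close>

lemma agreement_Exists:
  assumes "\<And>M. agreement p M (\<kappa> M) (\<nu> M)"
  shows "\<exists>K N. agreement (Exists i p) M K N"
proof -
  obtain K N where position_add_element: "\<And>n E E' R Z g. n \<ge> N \<Longrightarrow> contains_square n E \<Longrightarrow> contains_square n E' \<Longrightarrow> position n E E' K M R Z
    \<Longrightarrow> g \<in> carrier (heis n E)
    \<Longrightarrow> (\<exists>R' Z' M'. R \<subseteq> R' \<and> Z \<subseteq> Z' \<and> position n E E' (\<kappa> M') M' R' Z' \<and> \<nu> M' \<le> n
       \<and> (\<exists>g'\<in>carrier (heis n E'). related R' Z' g g'))"
    using position_add_element[of M \<kappa> \<nu>] by metis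
  have half: "sat (heis n E') e' (Exists i p)"
    if n: "n \<ge> N" and E: "contains_square n E" "contains_square n E'" and pos: "position n E E' K M R Z"
      and e: "range e \<subseteq> carrier (heis n E)" "range e' \<subseteq> carrier (heis n E')"
      and rel: "\<And>i. related R Z (e i) (e' i)"
      and sat: "sat (heis n E) e (Exists i p)" for n E E' R Z e e'
  proof -
    obtain g where g: "g \<in> carrier (heis n E)" "sat (heis n E) (e(i := g)) p"
      using sat by auto
    obtain R' Z' M' g' where 1: "R \<subseteq> R'" "Z \<subseteq> Z'" "position n E E' (\<kappa> M') M' R' Z'" "\<nu> M' \<le> n"
      and g': "g' \<in> carrier (heis n E')" "related R' Z' g g'"
      using position_add_element[OF n E pos g(1)] by blast
    have "related R' Z' ((e(i := g)) k) ((e'(i := g')) k)" for k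
      using g'(2) related_mono[OF rel 1(1,2)] by simp
    moreover have "range (e(i := g)) \<subseteq> carrier (heis n E)" "range (e'(i := g')) \<subseteq> carrier (heis n E')"
      using e g(1) g'(1) by auto
    ultimately have "sat (heis n E') (e'(i := g')) p"
      using agreementD[OF assms 1(4) E 1(3), of "e(i := g)" "e'(i := g')"] g(2) by blast
    then show ?thesis using g'(1) by auto
  qed
  have "agreement (Exists i p) M K N"
    unfolding agreement_def
  proof (intro allI impI, rule iffI, goal_cases)
    case (1 n E E' R Z e e')
    then show ?case using half[of n E E' R Z e e'] by blast
  next
    case (2 n E E' R Z e e')
    then show ?case
      using half[of n E' E "R\<inverse>" "Z\<inverse>" e' e] position_converse[of n E E' K M R Z]
      unfolding related_converse by blast
  qed
  then show ?thesis by blast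
qed

lemma agreement_exists: "\<exists>K N. agreement p M K N"
proof (induction p arbitrary: M)
  case (Eq s t)
  have "agreement (Eq s t) M 0 0"
    unfolding agreement_def
    by (auto simp del: split_paired_All simp: related_eq_iff related_gterm_val)
  then show ?case by blast
next
  case (Neg p)
  then show ?case unfolding agreement_def by simp
next
  case (Conj p q)
  obtain K N K' N' where "agreement p M K N" "agreement q M K' N'"
    using Conj by blast
  then have "agreement p M (K + K') (N + N')" "agreement q M (K + K') (N + N')"
    by (auto elim: agreement_mono)
  then have "agreement (Conj p q) M (K + K') (N + N')"
    unfolding agreement_def by simp
  then show ?case by blast
next
  case (Disj p q)
  obtain K N K' N' where "agreement p M K N" "agreement q M K' N'"
    using Disj by blast
  then have "agreement p M (K + K') (N + N')" "agreement q M (K + K') (N + N')"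
    by (auto elim: agreement_mono)
  then have "agreement (Disj p q) M (K + K') (N + N')"
    unfolding agreement_def by simp
  then show ?case by blast
next
  case (Impl p q)
  obtain K N K' N' where "agreement p M K N" "agreement q M K' N'"
    using Impl by blast
  then have "agreement p M (K + K') (N + N')" "agreement q M (K + K') (N + N')"
    by (auto elim: agreement_mono)
  then have "agreement (Impl p q) M (K + K') (N + N')"
    unfolding agreement_def by simp
  then show ?case by blast
next
  case (Exists i p)
  then obtain \<kappa> \<nu> where "\<And>M. agreement p M (\<kappa> M) (\<nu> M)" by metis
  then show ?case by (rule agreement_Exists)
next
  case (Forall i p)
  \<comment> \<open>Reduced to the existential quantifier by a double negation.\<close>
  then obtain \<kappa> \<nu> where "\<And>M. agreement p M (\<kappa> M) (\<nu> M)" by metis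
  then have "\<And>M. agreement (Neg p) M (\<kappa> M) (\<nu> M)"
    unfolding agreement_def by simp
  from agreement_Exists[OF this, of i M]
  obtain K N where "agreement (Exists i (Neg p)) M K N" by blast
  moreover have "sat G e (Forall i p) \<longleftrightarrow> \<not> sat G e (Exists i (Neg p))" for G :: "element monoid" and e
    by simp
  ultimately have "agreement (Forall i p) M K N"
    unfolding agreement_def by (simp only: not_iff) blast
  then show ?case by blast
qed

lemma position_initial:
  assumes "1 \<le> M" shows "position n E E' K M {(0, 0)} {(0, 0)}"
  using assms unfolding position_def matching_def low_rank_controlled_def lines_in_def
  by (auto simp: vecs_0 mats_0)

text \<open>
  For a sentence this reduces \<open>models\<close> to a single assignment.
\<close>

lemma sat_cong:
  assumes "\<And>i. i \<in> free_vars p \<Longrightarrow> e i = e' i"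
  shows "sat G e p \<longleftrightarrow> sat G e' p"
proof -
  have val: "gterm_val G e t = gterm_val G e' t" if "\<And>i. i \<in> vars_gterm t \<Longrightarrow> e i = e' i" for e e' t
    using that by (induction t) auto
  show ?thesis
    using assms
  proof (induction p arbitrary: e e')
    case (Eq s t)
    then show ?case using val[of s e e'] val[of t e e'] by simp
  next
    case (Neg p)
    then show ?case by (metis free_vars.simps(2) sat.simps(2))
  next
    case (Conj p q)
    have "sat G e p = sat G e' p" "sat G e q = sat G e' q"
      by (rule Conj.IH; use Conj.prems in simp)+
    then show ?case by simp
  next
    case (Disj p q)
    have "sat G e p = sat G e' p" "sat G e q = sat G e' q"
      by (rule Disj.IH; use Disj.prems in simp)+
    then show ?case by simp
  next
    case (Impl p q)
    have "sat G e p = sat G e' p" "sat G e q = sat G e' q"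
      by (rule Impl.IH; use Impl.prems in simp)+
    then show ?case by simp
  next
    case (Forall i p)
    have "sat G (e(i := x)) p = sat G (e'(i := x)) p" for x
      by (rule Forall.IH) (use Forall.prems in simp)
    then show ?case by simp
  next
    case (Exists i p)
    have "sat G (e(i := x)) p = sat G (e'(i := x)) p" for x
      by (rule Exists.IH) (use Exists.prems in simp)
    then show ?case by simp
  qed
qed

text \<open>
  The game starts from the trivial position, with all variables assigned to the unit. Its outcome does
  not depend on which entries outside the square are allowed in the matrices.
\<close>

lemma sentence_agreement:
  assumes "sentence \<sigma>"
  shows "\<exists>N. \<forall>n\<ge>N. \<forall>E E'. contains_square n E \<longrightarrow> contains_square n E' \<longrightarrow> (heis n E \<Turnstile> \<sigma> \<longleftrightarrow> heis n E' \<Turnstile> \<sigma>)"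
proof -
  obtain K N where agr: "agreement \<sigma> 1 K N" using agreement_exists by blast
  have models: "heis n E \<Turnstile> \<sigma> \<longleftrightarrow> sat (heis n E) (\<lambda>_. \<one>\<^bsub>heis n E\<^esub>) \<sigma>" if "contains_square n E" for n E
  proof -
    have "range (\<lambda>_. \<one>\<^bsub>heis n E\<^esub>) \<subseteq> carrier (heis n E)"
      using group.is_monoid[OF heis_group[OF that], THEN monoid.one_closed] by auto
    moreover have "sat (heis n E) e \<sigma> \<longleftrightarrow> sat (heis n E) e' \<sigma>" for e e'
      using assms by (intro sat_cong) (simp add: sentence_def)
    ultimately show ?thesis unfolding models_def by blast
  qed
  have "heis n E \<Turnstile> \<sigma> \<longleftrightarrow> heis n E' \<Turnstile> \<sigma>" if n: "n \<ge> N" and E: "contains_square n E" "contains_square n E'" for n E E'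
  proof -
    have pos: "position n E E' K 1 {(0, 0)} {(0, 0)}" by (rule position_initial) simp
    have one: "\<one>\<^bsub>heis n E\<^esub> \<in> carrier (heis n E)" "\<one>\<^bsub>heis n E'\<^esub> \<in> carrier (heis n E')"
      using E heis_group group.is_monoid monoid.one_closed by blast+
    show ?thesis
      unfolding models[OF E(1)] models[OF E(2)]
      by (rule agreementD[OF agr n E pos]) (use one related_one[OF pos] in auto)
  qed
  then show ?thesis by blast
qed

section \<open>Which of the groups are perfect\<close>

definition five_cycle :: "nat \<Rightarrow> nat" where
  "five_cycle = transpose 1 2 \<circ> transpose 2 3 \<circ> transpose 3 4 \<circ> transpose 4 5"

lemma five_cycle_values:
  "five_cycle 1 = 2" "five_cycle 2 = 3" "five_cycle 3 = 4" "five_cycle 4 = 5" "five_cycle 5 = 1"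
  by (simp_all add: five_cycle_def transpose_def)

lemma five_cycle_in_alt_group: "five_cycle \<in> carrier (alt_group 5)"
proof -
  have "five_cycle permutes {1..5}"
    unfolding five_cycle_def by (intro permutes_compose permutes_swap_id) auto
  moreover have "evenperm five_cycle"
    unfolding five_cycle_def
    by (simp add: evenperm_comp evenperm_swap permutation_swap_id permutation_compose)
  ultimately show ?thesis by (simp add: alt_group_carrier)
qed

lemma points_eq: "points = {1, 2, 3, 4, 5}"
  by (auto simp: points_def)

text \<open>
  On tuples with sum zero the five powers of the cycle \<open>c\<close> add up to zero. So in characteristic two
  \<open>u = v \<circ> c\<^sup>2 + v \<circ> c\<^sup>4\<close> satisfies \<open>u + u \<circ> c = v \<circ> c\<^sup>2 + v \<circ> c\<^sup>4 + v \<circ> c\<^sup>3 + v = v \<circ> c\<close>.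
\<close>

lemma five_cycle_difference:
  assumes v: "v \<in> tuples n"
  shows "\<exists>u\<in>tuples n. u \<circ> five_cycle = (v \<circ> five_cycle) + u"
proof -
  let ?c = five_cycle
  define u where "u = (v \<circ> ?c \<circ> ?c) + (v \<circ> ?c \<circ> ?c \<circ> ?c \<circ> ?c)"
  have c: "?c permutes points" by (rule alt_group_permutes[OF five_cycle_in_alt_group])
  have "u \<in> tuples n"
    unfolding u_def by (intro tuples_add tuples_permute c v)
  moreover have "(u \<circ> ?c) j = ((v \<circ> ?c) + u) j" for j
  proof (cases "j \<in> points")
    case False
    then have "?c j = j" using c by (simp add: permutes_def)
    then show ?thesis using v False by (simp add: u_def tuples_def)
  next
    case True
    have "(\<Sum>j\<in>points. v j) = 0" using v by (simp add: tuples_def)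
    then have sum: "v 1 + (v 2 + (v 3 + (v 4 + v 5))) = 0"
      by (simp add: points_eq)
    have "(u \<circ> ?c) j + ((v \<circ> ?c) + u) j = 0"
      unfolding sum[symmetric] using True
      by (auto simp only: points_eq insert_iff empty_iff u_def o_apply plus_fun_apply five_cycle_values
          ac_simps)
    then show ?thesis by (simp only: vec_add_eq_0_iff)
  qed
  ultimately show ?thesis by blast
qed

lemma (in group) derivedI:
  assumes "h \<in> carrier G" "k \<in> carrier G" "a \<in> carrier G" "h \<otimes> k = a \<otimes> (k \<otimes> h)"
  shows "a \<in> derived G (carrier G)"
proof -
  have "h \<otimes> k \<otimes> inv h \<otimes> inv k = a \<otimes> (k \<otimes> h) \<otimes> inv h \<otimes> inv k"
    using assms by simp
  also have "\<dots> = a" using assms(1-3) by (simp add: m_assoc r_inv inv_solve_right')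
  finally have "a \<in> derived_set G (carrier G)" using assms(1,2) by blast
  then show ?thesis unfolding derived_def by (rule generate.incl)
qed

text \<open>
  Supports that meet in one point make all but one term of the pairing vanish.
\<close>

lemma outer_eq_pairing:
  assumes "a \<in> vecs n" "b \<in> vecs n"
  shows "\<exists>u\<in>tuples n. \<exists>w\<in>tuples n. pairing u w = outer a b"
proof (intro bexI)
  show "pairing (0(1 := a, 2 := a)) (0(1 := b, 3 := b)) = outer a b"
    by (simp add: pairing_def points_eq)
  show "0(1 := a, 2 := a) \<in> tuples n" "0(1 := b, 3 := b) \<in> tuples n"
    using assms by (auto simp: tuples_def points_eq vecs_0 vec_add_self)
qed

text \<open>
  The alternating group is perfect. By \<open>five_cycle_difference\<close> every tuple is a commutator with the
  five-cycle. The commutator of two tuples is their pairing, so the derived subgroup contains all outer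
  products; these span the matrices supported in the square, as adding one row at a time shows. The
  number of commutators needed grows with \<open>n\<close>, as it must.
\<close>

lemma heis_perfect: "perfect_group (heis n ({..<n} \<times> {..<n}))"
proof -
  define E where "E = {..<n} \<times> {..<n}"
  have E: "contains_square n E" by (simp add: E_def contains_square_def)
  interpret G: group "heis n E" by (rule heis_group[OF E])
  let ?D = "derived (heis n E) (carrier (heis n E))"
  have one: "id \<in> carrier (alt_group 5)"
    using group.is_monoid[OF alt_group_is_group, THEN monoid.one_closed] by (simp add: alt_group_one)
  note calc = heis_mult heis_carrier comp_0 pairing_0 id_o o_id add_0 add_0_right
  have D_mult: "g \<otimes>\<^bsub>heis n E\<^esub> h \<in> ?D" if "g \<in> ?D" "h \<in> ?D" for g h
    using that subgroup.m_closed[OF G.derived_is_subgroup[OF subset_refl]] by blast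
  have S: "(s, 0, 0, 0) \<in> ?D" if "s \<in> carrier (alt_group 5)" for s
  proof -
    have "group_hom (alt_group 5) (heis n E) (\<lambda>s. (s, 0, 0, 0))"
      unfolding group_hom_def group_hom_axioms_def
      using alt_group_is_group G.group_axioms
      by (auto simp: hom_def calc tuples_0 mats_0 alt_group_mult)
    then interpret h: group_hom "alt_group 5" "heis n E" "\<lambda>s. (s, 0, 0, 0)" .
    have "(s, 0, 0, 0) \<in> (\<lambda>s. (s, 0, 0, 0)) ` derived (alt_group 5) (carrier (alt_group 5))"
      using that derived_alt_group_const[of 5] by auto
    also have "\<dots> = derived (heis n E) ((\<lambda>s. (s, 0, 0, 0)) ` carrier (alt_group 5))"
      using h.derived_img[of "carrier (alt_group 5)"] by simp
    also have "\<dots> \<subseteq> ?D"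
      by (rule G.mono_derived) (auto simp: calc tuples_0 mats_0)
    finally show ?thesis .
  qed
  have U: "(id, v, 0, 0) \<in> ?D" and W: "(id, 0, v, 0) \<in> ?D" if v: "v \<in> tuples n" for v
  proof -
    obtain u where u: "u \<in> tuples n" "u \<circ> five_cycle = (v \<circ> five_cycle) + u"
      using five_cycle_difference[OF v] by blast
    show "(id, v, 0, 0) \<in> ?D"
      by (rule G.derivedI[of "(id, u, 0, 0)" "(five_cycle, 0, 0, 0)"])
        (simp_all add: calc u v tuples_0 mats_0 one five_cycle_in_alt_group)
    show "(id, 0, v, 0) \<in> ?D"
      by (rule G.derivedI[of "(id, 0, u, 0)" "(five_cycle, 0, 0, 0)"])
        (simp_all add: calc u v tuples_0 mats_0 one five_cycle_in_alt_group)
  qed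
  have outer: "(id, 0, 0, outer a b) \<in> ?D" if ab: "a \<in> vecs n" "b \<in> vecs n" for a b
  proof -
    obtain u w where u: "u \<in> tuples n" "w \<in> tuples n" "pairing u w = outer a b"
      using outer_eq_pairing[OF ab] by blast
    show ?thesis
      by (rule G.derivedI[of "(id, u, 0, 0)" "(id, 0, w, 0)"])
        (simp_all add: calc u tuples_0 mats_0 one pairing_in_mats[OF E] flip: u(3))
  qed
  have rows: "(id, 0, 0, z) \<in> ?D" if "m \<le> n" "z \<in> mats E" "\<And>i. i \<ge> m \<Longrightarrow> z i = 0" for m z
    using that
  proof (induction m arbitrary: z)
    case 0
    then have "z = 0" by (simp add: fun_eq_iff)
    then show ?case using S[OF one] by (simp only:)
  next
    case (Suc m)
    have e: "(\<lambda>i. of_bool (i = m)) \<in> vecs n" "z m \<in> vecs n"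
      using Suc.prems(1,2) by (auto simp: vecs_def mats_def E_def)
    \<comment> \<open>What is cut off is the outer product of a unit vector with row \<open>m\<close>.\<close>
    have "(id, 0, 0, z(m := 0)) \<in> ?D"
    proof (rule Suc.IH)
      show "(z(m := 0)) i = 0" if "i \<ge> m" for i
        using Suc.prems(3)[of i] that by (cases "i = m") auto
    qed (use Suc.prems in \<open>auto simp: mats_def\<close>)
    from D_mult[OF this outer[OF e]]
    have "(id, 0, 0, z(m := 0) + outer (\<lambda>i. of_bool (i = m)) (z m)) \<in> ?D"
      by (simp only: calc)
    moreover have "z(m := 0) + outer (\<lambda>i. of_bool (i = m)) (z m) = z"
      by (auto simp: fun_eq_iff outer_def)
    ultimately show ?case by (simp only:)
  qed
  have "(s, u, w, z) \<in> ?D" if g: "(s, u, w, z) \<in> carrier (heis n E)" for s u w z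
  proof -
    have mem: "s \<in> carrier (alt_group 5)" "u \<in> tuples n" "w \<in> tuples n" "z \<in> mats E"
      using g by (simp_all add: heis_carrier)
    have "pairing u w + z \<in> mats E"
      by (intro mats_add pairing_in_mats[OF E] mem)
    moreover from this have "(pairing u w + z) i = 0" if "i \<ge> n" for i
      using that by (auto simp: mats_def E_def fun_eq_iff)
    ultimately have D: "(id, 0, 0, pairing u w + z) \<in> ?D"
      by (intro rows[of n]) auto
    \<comment> \<open>Multiplying the parts \<open>u\<close> and \<open>w\<close> shifts the matrix by \<open>pairing u w\<close>.\<close>
    have "pairing u w + z + pairing u w = z"
      by (metis add.commute mat_add_cancel)
    then show ?thesis
      using D_mult[OF S[OF mem(1)] D_mult[OF U[OF mem(2)] D_mult[OF W[OF mem(3)] D]]]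
      by (simp only: calc)
  qed
  then have "carrier (heis n E) \<subseteq> ?D" by auto
  then show ?thesis
    using G.derived_in_carrier[OF subset_refl] G.group_axioms
    unfolding perfect_group_def E_def by blast
qed

text \<open>
  If the entry at \<open>(n, n)\<close> is allowed, it is a nonzero homomorphism to the field of two elements, because
  pairings are supported in the smaller square.
\<close>

lemma heis_not_perfect: "\<not> perfect_group (heis n (insert (n, n) ({..<n} \<times> {..<n})))"
proof -
  define E where "E = insert (n, n) ({..<n} \<times> {..<n})"
  have E: "contains_square n E" by (auto simp: E_def contains_square_def)
  interpret G: group "heis n E" by (rule heis_group[OF E])
  define \<chi> :: "element \<Rightarrow> bit" where "\<chi> = (\<lambda>(s, u, w, z). z n n)"
  have hom: "\<chi> (g \<otimes>\<^bsub>heis n E\<^esub> h) = \<chi> g + \<chi> h"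
    if gh: "g \<in> carrier (heis n E)" "h \<in> carrier (heis n E)" for g h
  proof -
    obtain s u w z where g: "g = (s, u, w, z)" by (cases g)
    obtain t v x y where h: "h = (t, v, x, y)" by (cases h)
    have "pairing (u \<circ> t) x \<in> mats ({..<n} \<times> {..<n})"
      using gh by (intro pairing_in_mats tuples_permute)
        (auto simp: g h heis_carrier contains_square_def alt_group_permutes)
    then have "pairing (u \<circ> t) x n n = 0" by (simp add: mats_def)
    then show ?thesis by (simp add: g h \<chi>_def heis_mult)
  qed
  have \<chi>_one: "\<chi> \<one>\<^bsub>heis n E\<^esub> = 0" by (simp add: \<chi>_def heis_one)
  have \<chi>_inv: "\<chi> (inv\<^bsub>heis n E\<^esub> g) = \<chi> g" if "g \<in> carrier (heis n E)" for g
    using hom[of "inv\<^bsub>heis n E\<^esub> g" g] that \<chi>_one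
    by (cases "\<chi> g"; cases "\<chi> (inv\<^bsub>heis n E\<^esub> g)") auto
  let ?K = "{g \<in> carrier (heis n E). \<chi> g = 0}"
  have "subgroup ?K (heis n E)"
  proof (rule G.subgroupI)
    show "?K \<noteq> {}" using \<chi>_one G.one_closed by blast
  qed (auto simp: \<chi>_inv hom)
  moreover have "derived_set (heis n E) (carrier (heis n E)) \<subseteq> ?K"
    by (auto simp: hom \<chi>_inv algebra_simps bit_add_self)
  ultimately have "derived (heis n E) (carrier (heis n E)) \<subseteq> ?K"
    unfolding derived_def by (intro G.generate_subgroup_incl)
  moreover have "(id, 0, 0, \<lambda>i j. of_bool (i = n \<and> j = n)) \<in> carrier (heis n E)"
    using group.is_monoid[OF alt_group_is_group, THEN monoid.one_closed, of 5]
    by (auto simp: heis_carrier alt_group_one tuples_0 mats_def E_def)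
  moreover have "\<chi> (id, 0, 0, \<lambda>i j. of_bool (i = n \<and> j = n)) = 1"
    by (simp add: \<chi>_def)
  ultimately show ?thesis
    unfolding perfect_group_def E_def by auto
qed

theorem theorem2:
  shows "\<not> (\<exists>\<sigma>. sentence \<sigma> \<and>
           (\<forall>G :: nat monoid. group G \<and> finite (carrier G) \<longrightarrow> (G \<Turnstile> \<sigma> \<longleftrightarrow> perfect_group G)))"
proof
  assume "\<exists>\<sigma>. sentence \<sigma> \<and>
    (\<forall>G :: nat monoid. group G \<and> finite (carrier G) \<longrightarrow> (G \<Turnstile> \<sigma> \<longleftrightarrow> perfect_group G))"
  then obtain \<sigma> where \<sigma>: "sentence \<sigma>"
    and nat: "\<And>G :: nat monoid. group G \<Longrightarrow> finite (carrier G) \<Longrightarrow> G \<Turnstile> \<sigma> \<longleftrightarrow> perfect_group G"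
    by blast
  obtain n where n: "\<And>E E'. contains_square n E \<Longrightarrow> contains_square n E' \<Longrightarrow> heis n E \<Turnstile> \<sigma> \<longleftrightarrow> heis n E' \<Turnstile> \<sigma>"
    using sentence_agreement[OF \<sigma>] by blast
  let ?E = "{..<n} \<times> {..<n}" and ?E' = "insert (n, n) ({..<n} \<times> {..<n})"
  have E: "contains_square n ?E" "contains_square n ?E'" by (auto simp: contains_square_def)
  have "perfect_group (heis n ?E) \<longleftrightarrow> perfect_group (heis n ?E')"
    using n[OF E] characterises_perfect_if_nat[OF nat heis_group[OF E(1)] heis_finite[OF E(1)]]
      characterises_perfect_if_nat[OF nat heis_group[OF E(2)] heis_finite[OF E(2)]] by simp
  then show False using heis_perfect heis_not_perfect by blast
qed

end
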